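(* Let $p$ be an odd prime, $n\ge 2$, $K$ a field of characteristic $p$, and let $E$ be the Lyndon-Hochschild-Serre spectral sequence with coefficients in $K$ of the split extension $1\to M\to \mathrm{Heis}(p^n)\to Q\to 1$. The second differential of the element $\nu_3=x_1y_2-y_1x_2\in E_2^{0,3}=H^3(M;K)^Q$ is trivial, i.e. $d_2(\nu_3)=0$.
   Context: $\mathrm{Heis}(p^n)=Q\ltimes M$ with $M=C_{p^n}\times C_{p^n}=\langle a,b\rangle$, $Q=C_{p^n}=\langle\sigma\rangle$, $a^\sigma=ab$, $b^\sigma=b$. $H^\bullet(M;K)=\Lambda(x_1,y_1)\otimes K[x_2,y_2]$ with $x_1=a^*$, $y_1=b^*$ the dual classes in degree 1 and $x_2=\beta_n(x_1)$, $y_2=\beta_n(y_1)$ ($\beta_n$ the $n$-th Bockstein); the action of $Q$ is $\sigma x_i=x_i$, $\sigma y_i=x_i+y_i$ for $i=1,2$. The spectral sequence has $E_2^{r,s}=H^r(Q;H^s(M;K))$. *)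

theory Defs
  imports "HOL-Algebra.Elementary_Groups" "HOL-Computational_Algebra.Primes"
begin

section \<open>Group cohomology with trivial coefficients\<close>

text \<open>
  Normalised inhomogeneous cochains.  An \<open>s\<close>-cochain on \<open>G\<close> is a function on all lists that vanishes
  unless the list has length \<open>s\<close> and entries in \<open>carrier G - {\<one>}\<close>.
  Degrees are integers; the cochain groups of negative degree are zero.
\<close>

definition cochains :: "('g, 'm) monoid_scheme \<Rightarrow> int \<Rightarrow> ('g list \<Rightarrow> 'r::comm_ring_1) set" where
  "cochains G s =
     {f. \<forall>gs. f gs \<noteq> 0 \<longrightarrow> int (length gs) = s \<and> set gs \<subseteq> carrier G - {\<one>\<^bsub>G\<^esub>}}"

definition coboundary ::
    "('g, 'm) monoid_scheme \<Rightarrow> ('g list \<Rightarrow> 'r::comm_ring_1) \<Rightarrow> 'g list \<Rightarrow> 'r" where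
  "coboundary G f gs =
     (if gs \<noteq> [] \<and> set gs \<subseteq> carrier G
      then f (tl gs)
         + (\<Sum>i<length gs - 1.
              (- 1) ^ Suc i * f (take i gs @ (gs ! i \<otimes>\<^bsub>G\<^esub> gs ! Suc i) # drop (i + 2) gs))
         + (- 1) ^ length gs * f (butlast gs)
      else 0)"

definition function_group :: "('a \<Rightarrow> 'r::comm_ring_1) set \<Rightarrow> ('a \<Rightarrow> 'r) monoid" where
  "function_group A = \<lparr>carrier = A, monoid.mult = (\<lambda>f g x. f x + g x), one = (\<lambda>_. 0)\<rparr>"

definition cocycles :: "('g, 'm) monoid_scheme \<Rightarrow> int \<Rightarrow> ('g list \<Rightarrow> 'r::comm_ring_1) set" where
  "cocycles G s = {f \<in> cochains G s. coboundary G f = (\<lambda>_. 0)}"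

definition coboundaries :: "('g, 'm) monoid_scheme \<Rightarrow> int \<Rightarrow> ('g list \<Rightarrow> 'r::comm_ring_1) set" where
  "coboundaries G s = coboundary G ` cochains G (s - 1)"

definition cohomology ::
    "('g, 'm) monoid_scheme \<Rightarrow> int \<Rightarrow> ('g list \<Rightarrow> 'r::comm_ring_1) set monoid" where
  "cohomology G s = function_group (cocycles G s) Mod coboundaries G s"

definition coh_class ::
    "('g, 'm) monoid_scheme \<Rightarrow> int \<Rightarrow> ('g list \<Rightarrow> 'r::comm_ring_1) \<Rightarrow> ('g list \<Rightarrow> 'r) set" where
  "coh_class G s f = coboundaries G s #>\<^bsub>function_group (cocycles G s)\<^esub> f"

definition cup_cochain ::
    "int \<Rightarrow> ('g list \<Rightarrow> 'r::comm_ring_1) \<Rightarrow> ('g list \<Rightarrow> 'r) \<Rightarrow> 'g list \<Rightarrow> 'r" where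
  "cup_cochain s f g gs = f (take (nat s) gs) * g (drop (nat s) gs)"

definition cup ::
    "('g, 'm) monoid_scheme \<Rightarrow> int \<Rightarrow> int \<Rightarrow> ('g list \<Rightarrow> 'r::comm_ring_1) set \<Rightarrow> ('g list \<Rightarrow> 'r) set
       \<Rightarrow> ('g list \<Rightarrow> 'r) set" where
  "cup G s t u v = (\<Union>f\<in>u. \<Union>g\<in>v. coh_class G (s + t) (cup_cochain s f g))"

definition pullback ::
    "('h, 'm) monoid_scheme \<Rightarrow> ('h \<Rightarrow> 'g) \<Rightarrow> ('g list \<Rightarrow> 'r::comm_ring_1) \<Rightarrow> 'h list \<Rightarrow> 'r" where
  "pullback H \<phi> f hs = (if set hs \<subseteq> carrier H then f (map \<phi> hs) else 0)"

text \<open>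
  The map induced by a homomorphism \<open>\<phi>\<close> into \<open>G\<close> from \<open>H\<close>, on sets of cochains of \<open>G\<close> whose pullbacks
  are cocycles of \<open>H\<close> that differ by coboundaries.  It is used for cohomology classes of \<open>G\<close> and for
  elements of the left edge of the spectral sequence below.
\<close>

definition pullback_class ::
    "('h, 'm) monoid_scheme \<Rightarrow> ('h \<Rightarrow> 'g) \<Rightarrow> int \<Rightarrow> ('g list \<Rightarrow> 'r::comm_ring_1) set
       \<Rightarrow> ('h list \<Rightarrow> 'r) set" where
  "pullback_class H \<phi> s u = (\<Union>f\<in>u. coh_class H s (pullback H \<phi> f))"

definition cochain_of_hom ::
    "('g, 'm) monoid_scheme \<Rightarrow> ('g \<Rightarrow> 'r::comm_ring_1) \<Rightarrow> 'g list \<Rightarrow> 'r" where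
  "cochain_of_hom G \<chi> gs = (if length gs = 1 \<and> set gs \<subseteq> carrier G then \<chi> (hd gs) else 0)"

text \<open>
  The \<open>n\<close>-th Bockstein: if an integral cochain \<open>x\<close> has \<open>\<delta>x = p\<^sup>n y\<close>, it sends the class of \<open>x\<close> mod \<open>p\<close>
  to the class of \<open>y\<close> mod \<open>p\<close>.  Reduction mod \<open>p\<close> is \<open>of_int\<close> into a ring of characteristic \<open>p\<close>, so only
  classes defined over the prime field have such lifts.  In general \<open>\<beta>\<^sub>n\<close> is defined only modulo the
  images of the lower Bocksteins; these vanish on the degree-1 classes of \<open>C\<^sub>q \<times> C\<^sub>q\<close> with \<open>q = p\<^sup>n\<close>,
  where the value is thus unique.
\<close>

definition bockstein ::
    "('g, 'm) monoid_scheme \<Rightarrow> nat \<Rightarrow> nat \<Rightarrow> int \<Rightarrow> ('g list \<Rightarrow> 'r::comm_ring_1) set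
       \<Rightarrow> ('g list \<Rightarrow> 'r) set" where
  "bockstein G p n s u =
     (THE v. \<exists>x \<in> cochains G s. \<exists>y \<in> cochains G (s + 1).
        coboundary G x = (\<lambda>gs. int (p ^ n) * y gs) \<and>
        u = coh_class G s (\<lambda>gs. of_int (x gs)) \<and>
        v = coh_class G (s + 1) (\<lambda>gs. of_int (y gs)))"


section \<open>The Lyndon--Hochschild--Serre spectral sequence\<close>

text \<open>
  The spectral sequence of the filtration of Hochschild and Serre (1953) on the normalised
  cochains of \<open>G\<close>, for a normal subgroup \<open>N\<close>: an \<open>m\<close>-cochain lies in \<open>F\<^sup>r\<close> if it vanishes whenever at
  least \<open>m - r + 1\<close> of its arguments lie in \<open>N\<close>.  Thus \<open>F\<^sup>r\<close> is everything for \<open>r \<le> 0\<close> and zero for \<open>r > m\<close>.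
\<close>

definition lhs_filtration ::
    "('g, 'm) monoid_scheme \<Rightarrow> 'g set \<Rightarrow> int \<Rightarrow> int \<Rightarrow> ('g list \<Rightarrow> 'r::comm_ring_1) set" where
  "lhs_filtration G N r m =
     {f \<in> cochains G m.
        \<forall>gs. int (length (filter (\<lambda>g. g \<in> N) gs)) \<ge> m - r + 1 \<longrightarrow> f gs = 0}"

text \<open>
  The usual pages of a filtered complex:
  \<open>Z\<^sub>k\<^sup>r\<^sup>,\<^sup>s = {f \<in> F\<^sup>r C\<^sup>r\<^sup>+\<^sup>s. \<delta>f \<in> F\<^sup>r\<^sup>+\<^sup>k}\<close>,
  \<open>B\<^sub>k\<^sup>r\<^sup>,\<^sup>s = Z\<^sub>k\<^sub>-\<^sub>1\<^sup>r\<^sup>+\<^sup>1\<^sup>,\<^sup>s\<^sup>-\<^sup>1 + \<delta> Z\<^sub>k\<^sub>-\<^sub>1\<^sup>r\<^sup>-\<^sup>k\<^sup>+\<^sup>1\<^sup>,\<^sup>s\<^sup>+\<^sup>k\<^sup>-\<^sup>2\<close>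
  and \<open>E\<^sub>k\<^sup>r\<^sup>,\<^sup>s = Z\<^sub>k\<^sup>r\<^sup>,\<^sup>s / B\<^sub>k\<^sup>r\<^sup>,\<^sup>s\<close>, with \<open>d\<^sub>k\<close> induced by \<open>\<delta>\<close>.
\<close>

definition lhs_Z ::
    "('g, 'm) monoid_scheme \<Rightarrow> 'g set \<Rightarrow> int \<Rightarrow> int \<Rightarrow> int \<Rightarrow> ('g list \<Rightarrow> 'r::comm_ring_1) set" where
  "lhs_Z G N k r s =
     {f \<in> lhs_filtration G N r (r + s). coboundary G f \<in> lhs_filtration G N (r + k) (r + s + 1)}"

definition lhs_B ::
    "('g, 'm) monoid_scheme \<Rightarrow> 'g set \<Rightarrow> int \<Rightarrow> int \<Rightarrow> int \<Rightarrow> ('g list \<Rightarrow> 'r::comm_ring_1) set" where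
  "lhs_B G N k r s =
     {\<lambda>gs. f gs + coboundary G h gs | f h.
        f \<in> lhs_Z G N (k - 1) (r + 1) (s - 1) \<and> h \<in> lhs_Z G N (k - 1) (r - k + 1) (s + k - 2)}"

definition lhs_E ::
    "('g, 'm) monoid_scheme \<Rightarrow> 'g set \<Rightarrow> int \<Rightarrow> int \<Rightarrow> int
       \<Rightarrow> ('g list \<Rightarrow> 'r::comm_ring_1) set monoid" where
  "lhs_E G N k r s = function_group (lhs_Z G N k r s) Mod lhs_B G N k r s"

definition lhs_d ::
    "('g, 'm) monoid_scheme \<Rightarrow> 'g set \<Rightarrow> int \<Rightarrow> int \<Rightarrow> int \<Rightarrow> ('g list \<Rightarrow> 'r::comm_ring_1) set
       \<Rightarrow> ('g list \<Rightarrow> 'r) set" where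
  "lhs_d G N k r s \<xi> =
     (\<Union>f\<in>\<xi>. lhs_B G N k (r + k) (s - k + 1)
        #>\<^bsub>function_group (lhs_Z G N k (r + k) (s - k + 1))\<^esub> coboundary G f)"


section \<open>The groups \<open>Heis(p\<^sup>n)\<close>\<close>

text \<open>\<open>(q, m)\<close> stands for the product \<open>q m\<close>, and \<open>\<alpha> q m\<close> for \<open>m\<^sup>q = q\<^sup>-\<^sup>1 m q\<close>.\<close>

definition semidirect ::
    "('q, 'x) monoid_scheme \<Rightarrow> ('m, 'y) monoid_scheme \<Rightarrow> ('q \<Rightarrow> 'm \<Rightarrow> 'm) \<Rightarrow> ('q \<times> 'm) monoid" where
  "semidirect Q M \<alpha> =
     \<lparr>carrier = carrier Q \<times> carrier M,
      monoid.mult = (\<lambda>(q, m) (q', m'). (q \<otimes>\<^bsub>Q\<^esub> q', \<alpha> q' m \<otimes>\<^bsub>M\<^esub> m')),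
      one = (\<one>\<^bsub>Q\<^esub>, \<one>\<^bsub>M\<^esub>)\<rparr>"

definition heis_Q :: "nat \<Rightarrow> nat \<Rightarrow> int monoid" where
  "heis_Q p n = integer_mod_group (p ^ n)"

text \<open>\<open>(i, j)\<close> stands for \<open>a\<^sup>i b\<^sup>j\<close>.\<close>

definition heis_M :: "nat \<Rightarrow> nat \<Rightarrow> (int \<times> int) monoid" where
  "heis_M p n = integer_mod_group (p ^ n) \<times>\<times> integer_mod_group (p ^ n)"

text \<open>From \<open>a\<^sup>\<sigma> = a b\<close> and \<open>b\<^sup>\<sigma> = b\<close> one gets \<open>(a\<^sup>i b\<^sup>j)\<^sup>\<tau> = a\<^sup>i b\<^sup>j\<^sup>+\<^sup>k\<^sup>i\<close> for \<open>\<tau> = \<sigma>\<^sup>k\<close>.\<close>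

definition heis_act :: "nat \<Rightarrow> nat \<Rightarrow> int \<Rightarrow> int \<times> int \<Rightarrow> int \<times> int" where
  "heis_act p n k = (\<lambda>(i, j). (i, (j + k * i) mod int (p ^ n)))"

definition heis :: "nat \<Rightarrow> nat \<Rightarrow> (int \<times> int \<times> int) monoid" where
  "heis p n = semidirect (heis_Q p n) (heis_M p n) (heis_act p n)"

definition heis_incl :: "int \<times> int \<Rightarrow> int \<times> int \<times> int" where
  "heis_incl m = (0, m)"

definition heis_N :: "nat \<Rightarrow> nat \<Rightarrow> (int \<times> int \<times> int) set" where
  "heis_N p n = heis_incl ` carrier (heis_M p n)"

text \<open>The classes \<open>a\<^sup>*\<close> and \<open>b\<^sup>*\<close> of the homomorphisms \<open>M \<rightarrow> K\<close> dual to \<open>a, b\<close>, where \<open>char K = p\<close>.\<close>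

definition heis_a_dual :: "nat \<Rightarrow> nat \<Rightarrow> ((int \<times> int) list \<Rightarrow> 'k::field) set" where
  "heis_a_dual p n = coh_class (heis_M p n) 1 (cochain_of_hom (heis_M p n) (\<lambda>(i, j). of_int i))"

definition heis_b_dual :: "nat \<Rightarrow> nat \<Rightarrow> ((int \<times> int) list \<Rightarrow> 'k::field) set" where
  "heis_b_dual p n = coh_class (heis_M p n) 1 (cochain_of_hom (heis_M p n) (\<lambda>(i, j). of_int j))"

definition heis_invariants :: "nat \<Rightarrow> nat \<Rightarrow> int \<Rightarrow> ((int \<times> int) list \<Rightarrow> 'k::field) set set" where
  "heis_invariants p n s =
     {u \<in> carrier (cohomology (heis_M p n) s).
        \<forall>k \<in> carrier (heis_Q p n). pullback_class (heis_M p n) (heis_act p n k) s u = u}"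

definition heis_E ::
    "nat \<Rightarrow> nat \<Rightarrow> int \<Rightarrow> int \<Rightarrow> int \<Rightarrow> ((int \<times> int \<times> int) list \<Rightarrow> 'k::field) set monoid" where
  "heis_E p n k r s = lhs_E (heis p n) (heis_N p n) k r s"

definition heis_d ::
    "nat \<Rightarrow> nat \<Rightarrow> int \<Rightarrow> int \<Rightarrow> int \<Rightarrow> ((int \<times> int \<times> int) list \<Rightarrow> 'k::field) set
       \<Rightarrow> ((int \<times> int \<times> int) list \<Rightarrow> 'k) set" where
  "heis_d p n k r s = lhs_d (heis p n) (heis_N p n) k r s"

text \<open>
  The identification of \<open>E\<^sub>2\<^sup>0\<^sup>,\<^sup>s\<close> with \<open>H\<^sup>s(M; K)\<^sup>Q\<close> (Hochschild and Serre) is restriction of cochains to \<open>M\<close>.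
\<close>

definition heis_edge ::
    "nat \<Rightarrow> nat \<Rightarrow> int \<Rightarrow> ((int \<times> int \<times> int) list \<Rightarrow> 'k::field) set
       \<Rightarrow> ((int \<times> int) list \<Rightarrow> 'k) set" where
  "heis_edge p n s \<xi> = pullback_class (heis_M p n) heis_incl s \<xi>"

end

theory Submission
  imports Defs
begin

text \<open>
  The element \<open>\<nu>\<^sub>3\<close> is the restriction of a class of \<open>G = Heis(p\<^sup>n)\<close>, hence a permanent cycle.  In the
  coordinates \<open>(k, i, j)\<close> of \<open>G\<close> the cochain \<open>i \<union> j + (i choose 2) \<union> k\<close> is a cocycle modulo \<open>p\<^sup>n\<close>
  because \<open>p\<close> is odd, and it restricts to \<open>x\<^sub>1 y\<^sub>1\<close> on \<open>M\<close>.  Its Bockstein is the reduction of an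
  integral cocycle and restricts to \<open>\<beta>\<^sub>n(x\<^sub>1 y\<^sub>1) = x\<^sub>2 y\<^sub>1 - x\<^sub>1 y\<^sub>2 = - \<nu>\<^sub>3\<close>.
\<close>

section \<open>Cochains\<close>

text \<open>The cochain \<open>i \<union> j\<close> alone does not work because \<open>j\<close> is
  not additive on \<open>G\<close>: the product of \<open>(k, i, j)\<close> and
  \<open>(k', i', j')\<close> has last coordinate \<open>j + k' i + j'\<close>, so the coboundary of
  \<open>i \<union> j\<close> is \<open>i \<union> i \<union> k\<close> modulo \<open>p^n\<close>.
  The square \<open>i \<union> i\<close> is bounded by \<open>- (i choose 2)\<close>. For odd
  \<open>p\<close> this function is well defined modulo \<open>p^n\<close>, because
  \<open>p^n\<close> divides \<open>p^n (p^n - 1) / 2\<close>; hence the correction term. The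
  integers have no torsion, so the coboundary divided by \<open>p^n\<close> is an exact cocycle, and
  only then is it reduced to \<open>K\<close>. Its restriction to \<open>M\<close> is invariant
  under \<open>Q\<close> since inner automorphisms of \<open>G\<close> act trivially on cohomology.
  Two definitions need care. The page consists of cosets of cochains on \<open>G\<close>, so
  \<open>\<nu>3\<close> names one of its elements only once that element is shown to be determined
  by its restriction to \<open>M\<close>. And \<open>bockstein\<close> is a definite description,
  whose value is known only after independence of the lift.\<close>

lemma cochainsD:
  assumes "f \<in> cochains G s" "\<not> (int (length gs) = s \<and> set gs \<subseteq> carrier G - {\<one>\<^bsub>G\<^esub>})"
  shows "f gs = 0"
  using assms by (auto simp: cochains_def)

lemma cochains_one:
  assumes "f \<in> cochains G s" "\<one>\<^bsub>G\<^esub> \<in> set gs"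
  shows "f gs = 0"
  using assms by (auto intro: cochainsD)

lemma cochains_eqI:
  assumes "f \<in> cochains G s" "g \<in> cochains G s"
    and "\<And>gs. int (length gs) = s \<Longrightarrow> set gs \<subseteq> carrier G \<Longrightarrow> f gs = g gs"
  shows "f = g"
proof
  fix gs
  show "f gs = g gs"
  proof (cases "int (length gs) = s \<and> set gs \<subseteq> carrier G")
    case False
    then have "f gs = 0" "g gs = 0"
      using assms(1,2) by (auto intro!: cochainsD)
    then show ?thesis by simp
  qed (use assms(3) in auto)
qed

lemma cochains_diff:
  "f \<in> cochains G s \<Longrightarrow> g \<in> cochains G s \<Longrightarrow> (\<lambda>gs. f gs - g gs) \<in> cochains G s"
  unfolding cochains_def by (rule CollectI, intro allI impI) (metis (mono_tags, lifting) CollectD diff_0_right)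

lemma cochains_uminus: "f \<in> cochains G s \<Longrightarrow> (\<lambda>gs. - f gs) \<in> cochains G s"
  by (auto simp: cochains_def)

lemma cochains_zero [simp]: "(\<lambda>gs. 0) \<in> cochains G s"
  by (auto simp: cochains_def)

lemma cochains_of_int: "x \<in> cochains G s \<Longrightarrow> (\<lambda>gs. of_int (x gs)) \<in> cochains G s"
  unfolding cochains_def by (rule CollectI, intro allI impI) (metis (mono_tags, lifting) CollectD of_int_0)

lemma coboundary_add:
  "coboundary G (\<lambda>gs. f gs + g gs) = (\<lambda>gs. coboundary G f gs + coboundary G g gs)"
  by (rule ext) (simp add: coboundary_def distrib_left sum.distrib sum_subtractf sum_negf)

lemma coboundary_mult: "coboundary G (\<lambda>gs. c * f gs) = (\<lambda>gs. c * coboundary G f gs)"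
  by (rule ext) (simp add: coboundary_def sum_distrib_left algebra_simps)

lemma coboundary_uminus: "coboundary G (\<lambda>gs. - f gs) = (\<lambda>gs. - coboundary G f gs)"
  using coboundary_mult[of G "- 1" f] by simp

lemma coboundary_diff:
  "coboundary G (\<lambda>gs. f gs - g gs) = (\<lambda>gs. coboundary G f gs - coboundary G g gs)"
  using coboundary_add[of G f "\<lambda>gs. - g gs"] by (simp add: coboundary_uminus)

lemma coboundary_zero [simp]: "coboundary G (\<lambda>gs. 0) = (\<lambda>gs. 0)"
  by (rule ext) (simp add: coboundary_def)

lemma coboundary_of_int:
  "coboundary G (\<lambda>gs. of_int (x gs)) = (\<lambda>gs. of_int (coboundary G x gs))"
  by (rule ext) (simp add: coboundary_def)

lemma coboundary_outside:
  assumes "f \<in> cochains G s" "\<not> (int (length gs) = s + 1 \<and> set gs \<subseteq> carrier G)"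
  shows "coboundary G f gs = 0"
proof (cases "gs \<noteq> [] \<and> set gs \<subseteq> carrier G")
  case True
  have *: "f hs = 0" if "length gs = Suc (length hs)" for hs
    using assms True that by (intro cochainsD[OF assms(1)]) auto
  show ?thesis
    using True by (auto simp: coboundary_def * intro: sum.neutral)
qed (auto simp: coboundary_def)

section \<open>Coboundaries and cochains on explicit lists of small length\<close>

lemma coboundary_1: "a \<in> carrier G \<Longrightarrow> coboundary G f [a] = 0"
  by (simp add: coboundary_def)

lemma coboundary_2:
  "{a, b} \<subseteq> carrier G \<Longrightarrow> coboundary G f [a, b] = f [b] - f [a \<otimes>\<^bsub>G\<^esub> b] + f [a]"
  by (simp add: coboundary_def)

lemma coboundary_3:
  "{a, b, c} \<subseteq> carrier G \<Longrightarrow> coboundary G f [a, b, c] =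
     f [b, c] - f [a \<otimes>\<^bsub>G\<^esub> b, c] + f [a, b \<otimes>\<^bsub>G\<^esub> c] - f [a, b]"
  by (simp add: coboundary_def numeral_2_eq_2)

lemma coboundary_4:
  "{a, b, c, d} \<subseteq> carrier G \<Longrightarrow> coboundary G f [a, b, c, d] =
     f [b, c, d] - f [a \<otimes>\<^bsub>G\<^esub> b, c, d] + f [a, b \<otimes>\<^bsub>G\<^esub> c, d] - f [a, b, c \<otimes>\<^bsub>G\<^esub> d] + f [a, b, c]"
  by (simp add: coboundary_def numeral_2_eq_2 numeral_3_eq_3)

lemma length_1_conv: "length xs = 1 \<longleftrightarrow> (\<exists>a. xs = [a])"
  by (auto simp: length_Suc_conv)

lemma length_2_conv: "length xs = 2 \<longleftrightarrow> (\<exists>a b. xs = [a, b])"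
  by (auto simp: numeral_2_eq_2 length_Suc_conv)

lemma length_3_conv: "length xs = 3 \<longleftrightarrow> (\<exists>a b c. xs = [a, b, c])"
  by (auto simp: numeral_3_eq_3 length_Suc_conv)

lemma length_4_conv: "length xs = 4 \<longleftrightarrow> (\<exists>a b c d. xs = [a, b, c, d])"
  by (auto simp: eval_nat_numeral length_Suc_conv)

lemma cochains_1I:
  assumes "\<And>gs. length gs \<noteq> 1 \<or> \<not> set gs \<subseteq> carrier G \<Longrightarrow> f gs = 0" and "f [\<one>\<^bsub>G\<^esub>] = 0"
  shows "f \<in> cochains G 1"
proof -
  have "int (length gs) = 1 \<and> set gs \<subseteq> carrier G - {\<one>\<^bsub>G\<^esub>}" if nz: "f gs \<noteq> 0" for gs
  proof -
    have "length gs = 1" "set gs \<subseteq> carrier G"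
      using assms(1)[of gs] nz by auto
    then obtain a where "gs = [a]" "a \<in> carrier G"
      unfolding length_1_conv by auto
    then show ?thesis
      using assms(2) nz by auto
  qed
  then show ?thesis
    unfolding cochains_def by (intro CollectI allI impI)
qed

lemma cochains_2I:
  assumes "\<And>gs. length gs \<noteq> 2 \<or> \<not> set gs \<subseteq> carrier G \<Longrightarrow> f gs = 0"
    and "\<And>a. a \<in> carrier G \<Longrightarrow> f [\<one>\<^bsub>G\<^esub>, a] = 0" "\<And>a. a \<in> carrier G \<Longrightarrow> f [a, \<one>\<^bsub>G\<^esub>] = 0"
  shows "f \<in> cochains G 2"
proof -
  have "int (length gs) = 2 \<and> set gs \<subseteq> carrier G - {\<one>\<^bsub>G\<^esub>}" if nz: "f gs \<noteq> 0" for gs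
  proof -
    have "length gs = 2" "set gs \<subseteq> carrier G"
      using assms(1)[of gs] nz by auto
    then obtain a b where "gs = [a, b]" "a \<in> carrier G" "b \<in> carrier G"
      by (auto simp: length_2_conv)
    then show ?thesis
      using assms(2)[of b] assms(3)[of a] nz by auto
  qed
  then show ?thesis
    unfolding cochains_def by (intro CollectI allI impI)
qed

lemma cochains_3I:
  assumes "\<And>gs. length gs \<noteq> 3 \<or> \<not> set gs \<subseteq> carrier G \<Longrightarrow> f gs = 0"
    and "\<And>a b. a \<in> carrier G \<Longrightarrow> b \<in> carrier G \<Longrightarrow>
           f [\<one>\<^bsub>G\<^esub>, a, b] = 0 \<and> f [a, \<one>\<^bsub>G\<^esub>, b] = 0 \<and> f [a, b, \<one>\<^bsub>G\<^esub>] = 0"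
  shows "f \<in> cochains G 3"
proof -
  have "int (length gs) = 3 \<and> set gs \<subseteq> carrier G - {\<one>\<^bsub>G\<^esub>}" if nz: "f gs \<noteq> 0" for gs
  proof -
    have "length gs = 3" "set gs \<subseteq> carrier G"
      using assms(1)[of gs] nz by auto
    then obtain a b c where "gs = [a, b, c]" "a \<in> carrier G" "b \<in> carrier G" "c \<in> carrier G"
      by (auto simp: length_3_conv)
    then show ?thesis
      using assms(2)[of b c] assms(2)[of a c] assms(2)[of a b] nz by auto
  qed
  then show ?thesis
    unfolding cochains_def by (intro CollectI allI impI)
qed

context monoid
begin

text \<open>An argument equal to the identity makes two neighbouring terms cancel, and every other
  term still contains the identity. Only lists of length at most 4 occur, so this and
  \<open>\<delta>\<delta> = 0\<close> are checked on explicit lists rather than through the general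
  simplicial identities.\<close>

lemma coboundary_cochains_1:
  assumes f: "f \<in> cochains G 1"
  shows "coboundary G f \<in> cochains G 2"
proof (rule cochains_2I)
  show "coboundary G f gs = 0" if "length gs \<noteq> 2 \<or> \<not> set gs \<subseteq> carrier G" for gs
    using coboundary_outside[OF f, of gs] that by auto
qed (use cochains_one[OF f] in \<open>auto simp: coboundary_2\<close>)

lemma coboundary_cochains_2:
  assumes f: "f \<in> cochains G 2"
  shows "coboundary G f \<in> cochains G 3"
proof (rule cochains_3I)
  show "coboundary G f gs = 0" if "length gs \<noteq> 3 \<or> \<not> set gs \<subseteq> carrier G" for gs
    using coboundary_outside[OF f, of gs] that by auto
qed (use cochains_one[OF f] in \<open>auto simp: coboundary_3\<close>)

lemma coboundary_coboundary_1:
  assumes f: "f \<in> cochains G 1"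
  shows "coboundary G (coboundary G f) = (\<lambda>_. 0)"
proof (rule ext)
  fix gs
  show "coboundary G (coboundary G f) gs = 0"
  proof (cases "length gs = 3 \<and> set gs \<subseteq> carrier G")
    case True
    then obtain a b c where "gs = [a, b, c]" "{a, b, c} \<subseteq> carrier G"
      by (auto simp: length_3_conv)
    then show ?thesis by (simp add: coboundary_3 coboundary_2 m_assoc)
  next
    case False
    then show ?thesis
      using coboundary_outside[OF coboundary_cochains_1[OF f], of gs] by auto
  qed
qed

lemma coboundary_coboundary_2:
  assumes f: "f \<in> cochains G 2"
  shows "coboundary G (coboundary G f) = (\<lambda>_. 0)"
proof (rule ext)
  fix gs
  show "coboundary G (coboundary G f) gs = 0"
  proof (cases "length gs = 4 \<and> set gs \<subseteq> carrier G")
    case True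
    then obtain a b c d where "gs = [a, b, c, d]" "{a, b, c, d} \<subseteq> carrier G"
      by (auto simp: length_4_conv)
    then show ?thesis by (simp add: coboundary_4 coboundary_3 m_assoc)
  next
    case False
    then show ?thesis
      using coboundary_outside[OF coboundary_cochains_2[OF f], of gs] by auto
  qed
qed

end


section \<open>Cohomology classes as cosets\<close>

text \<open>The one-step subgroup test for a bare set of functions. No ambient group is mentioned,
  so the same predicate serves for cochains, cocycles, coboundaries and the terms \<open>Z\<close>
  and \<open>B\<close> of the spectral sequence.\<close>

definition additive_subgroup :: "('a \<Rightarrow> 'r::comm_ring_1) set \<Rightarrow> bool" where
  "additive_subgroup A \<longleftrightarrow>
     (\<lambda>_. 0) \<in> A \<and> (\<forall>f \<in> A. \<forall>g \<in> A. (\<lambda>x. f x - g x) \<in> A)"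

lemma additive_subgroup_uminus:
  assumes "additive_subgroup A" "f \<in> A"
  shows "(\<lambda>x. - f x) \<in> A"
proof -
  have *: "(\<lambda>x. g x - f x) \<in> A" if "g \<in> A" for g
    using assms that by (simp add: additive_subgroup_def)
  show ?thesis
    using *[of "\<lambda>_. 0"] assms(1) by (simp add: additive_subgroup_def)
qed

lemma additive_subgroup_add:
  assumes "additive_subgroup A" "f \<in> A" "g \<in> A"
  shows "(\<lambda>x. f x + g x) \<in> A"
proof -
  have "(\<lambda>x. f x - (- g x)) \<in> A"
    using assms(1,2) additive_subgroup_uminus[OF assms(1,3)] unfolding additive_subgroup_def
    by fast
  then show ?thesis by simp
qed

lemma comm_group_function_group:
  assumes A: "additive_subgroup A"
  shows "comm_group (function_group A)"
proof (rule comm_groupI)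
  fix f assume f: "f \<in> carrier (function_group A)"
  show "\<exists>g \<in> carrier (function_group A). g \<otimes>\<^bsub>function_group A\<^esub> f = \<one>\<^bsub>function_group A\<^esub>"
    using f additive_subgroup_uminus[OF A]
    by (intro bexI[of _ "\<lambda>x. - f x"]) (auto simp: function_group_def)
qed (use A additive_subgroup_add[OF A] in
      \<open>auto simp: function_group_def algebra_simps additive_subgroup_def\<close>)

lemma inv_function_group:
  assumes A: "additive_subgroup A" "f \<in> A"
  shows "inv\<^bsub>function_group A\<^esub> f = (\<lambda>x. - f x)"
proof -
  interpret comm_group "function_group A"
    by (rule comm_group_function_group[OF A(1)])
  show ?thesis
    using additive_subgroup_uminus[OF A] A(2)
    by (intro inv_equality) (auto simp: function_group_def)
qed

lemma normal_function_group:
  assumes "additive_subgroup A" "additive_subgroup B" "B \<subseteq> A"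
  shows "B \<lhd> function_group A"
proof -
  interpret comm_group "function_group A"
    by (rule comm_group_function_group[OF assms(1)])
  have "subgroup B (function_group A)"
    using assms(2,3) inv_function_group[OF assms(1)] additive_subgroup_add[OF assms(2)]
      additive_subgroup_uminus[OF assms(2)]
    by (intro subgroupI) (auto simp: function_group_def additive_subgroup_def)
  then show ?thesis by (simp add: normal_iff_subgroup)
qed

text \<open>A coset depends only on the pointwise addition, which is the same for every carrier
  \<open>C\<close>. One rule therefore covers cohomology classes and elements of the pages.\<close>

lemma mem_coset_iff: "h \<in> A #>\<^bsub>function_group C\<^esub> f \<longleftrightarrow> (\<lambda>x. h x - f x) \<in> A"
proof
  assume "(\<lambda>x. h x - f x) \<in> A"
  then show "h \<in> A #>\<^bsub>function_group C\<^esub> f"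
    unfolding r_coset_def function_group_def by (auto intro!: bexI[of _ "\<lambda>x. h x - f x"])
qed (auto simp: r_coset_def function_group_def)

lemma coset_eqI:
  assumes A: "additive_subgroup A" "(\<lambda>x. f x - g x) \<in> A"
  shows "A #>\<^bsub>function_group C\<^esub> f = A #>\<^bsub>function_group C\<^esub> g"
proof -
  have "(\<lambda>x. h x - f x) \<in> A \<longleftrightarrow> (\<lambda>x. h x - g x) \<in> A" for h
    using additive_subgroup_add[OF A(1) _ A(2), of "\<lambda>x. h x - f x"]
      additive_subgroup_add[OF A(1) _ additive_subgroup_uminus[OF A], of "\<lambda>x. h x - g x"]
    by auto
  then show ?thesis by (auto simp: mem_coset_iff)
qed

lemma coset_absorb:
  assumes "additive_subgroup A" "f \<in> A"
  shows "A #>\<^bsub>function_group C\<^esub> f = A"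
proof -
  have "A #>\<^bsub>function_group C\<^esub> f = A #>\<^bsub>function_group C\<^esub> (\<lambda>_. 0)"
    using assms by (intro coset_eqI) simp_all
  also have "\<dots> = A"
    by (rule Set.set_eqI) (simp add: mem_coset_iff)
  finally show ?thesis .
qed

lemma coset_self: "additive_subgroup A \<Longrightarrow> f \<in> A #>\<^bsub>function_group C\<^esub> f"
  unfolding mem_coset_iff additive_subgroup_def by simp

section \<open>Cocycles, coboundaries and their classes\<close>

lemma additive_subgroup_cochains: "additive_subgroup (cochains G s)"
  unfolding additive_subgroup_def by (intro conjI ballI cochains_diff cochains_zero)

lemma additive_subgroup_coboundaries: "additive_subgroup (coboundaries G s :: ('g list \<Rightarrow> 'r::comm_ring_1) set)"
  unfolding additive_subgroup_def coboundaries_def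
proof (intro conjI ballI)
  show "(\<lambda>_. 0) \<in> coboundary G ` cochains G (s - 1)"
    by (rule image_eqI[of _ _ "\<lambda>_. 0"]) auto
next
  fix f g :: "'g list \<Rightarrow> 'r" assume "f \<in> coboundary G ` cochains G (s - 1)" "g \<in> coboundary G ` cochains G (s - 1)"
  then obtain f' g' where "f' \<in> cochains G (s - 1)" "g' \<in> cochains G (s - 1)"
    and fg: "f = coboundary G f'" "g = coboundary G g'" by blast
  then have "(\<lambda>x. f' x - g' x) \<in> cochains G (s - 1)"
    by (intro cochains_diff)
  then show "(\<lambda>x. f x - g x) \<in> coboundary G ` cochains G (s - 1)"
    unfolding fg by (intro image_eqI[of _ _ "\<lambda>x. f' x - g' x"]) (simp_all add: coboundary_diff)
qed

lemma additive_subgroup_cocycles: "additive_subgroup (cocycles G s)"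
  unfolding additive_subgroup_def cocycles_def by (simp add: coboundary_diff) (intro allI impI cochains_diff; simp)

lemma mem_coh_class: "h \<in> coh_class G s f \<longleftrightarrow> (\<lambda>x. h x - f x) \<in> coboundaries G s"
  by (simp add: coh_class_def mem_coset_iff)

lemma coh_class_self: "f \<in> coh_class G s f"
  by (simp add: coh_class_def coset_self additive_subgroup_coboundaries)

lemma coh_class_eqI:
  "(\<lambda>x. f x - g x) \<in> coboundaries G s \<Longrightarrow> coh_class G s f = coh_class G s g"
  by (simp add: coh_class_def coset_eqI additive_subgroup_coboundaries)

lemma coh_class_eq_iff:
  "coh_class G s f = coh_class G s g \<longleftrightarrow> (\<lambda>x. f x - g x) \<in> coboundaries G s"
  using coh_class_eqI coh_class_self mem_coh_class by metis

text \<open>With trivial coefficients the two terms \<open>f []\<close> of the coboundary of a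
  0-cochain cancel. A class of degree 1 is thus a single function, which keeps both the cup product
  and the Bockstein of such classes manageable.\<close>

lemma coboundaries_1: "coboundaries G 1 = {\<lambda>_ :: 'g list. 0 :: 'r::comm_ring_1}"
proof -
  have "coboundary G f = (\<lambda>_. 0)" if f: "f \<in> cochains G 0" for f :: "'g list \<Rightarrow> 'r"
  proof
    fix gs
    show "coboundary G f gs = 0"
      using coboundary_outside[OF f, of gs] coboundary_1[of _ G f]
      by (cases "length gs = 1 \<and> set gs \<subseteq> carrier G") (auto simp: length_1_conv[unfolded One_nat_def])
  qed
  then show ?thesis
    unfolding coboundaries_def by (auto intro!: image_eqI[of _ _ "\<lambda>_. 0"])
qed

lemma coh_class_1: "coh_class G 1 f = {f}"
  by (auto simp: mem_coh_class coboundaries_1 fun_eq_iff)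

lemma coh_class_in_cohomology: "f \<in> cocycles G s \<Longrightarrow> coh_class G s f \<in> carrier (cohomology G s)"
  unfolding cohomology_def FactGroup_def RCOSETS_def coh_class_def
  by (auto simp: function_group_def)

context monoid
begin

lemma coboundaries_subset_cocycles_3: "coboundaries G 3 \<subseteq> cocycles G 3"
  using coboundary_cochains_2 coboundary_coboundary_2
  by (auto simp: coboundaries_def cocycles_def)

text \<open>Moves the product and the inverse of the factor group, in which \<open>\<nu>3\<close> is
  written, to representatives.\<close>

lemma coh_class_diff_3:
  assumes f: "f \<in> cocycles G 3" and g: "g \<in> cocycles G 3"
  shows "coh_class G 3 f \<otimes>\<^bsub>cohomology G 3\<^esub> inv\<^bsub>cohomology G 3\<^esub> coh_class G 3 g
    = coh_class G 3 (\<lambda>x. f x - g x)"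
proof -
  let ?Z = "cocycles G 3 :: ('a list \<Rightarrow> 'c) set" and ?B = "coboundaries G 3 :: ('a list \<Rightarrow> 'c) set"
  interpret normal ?B "function_group ?Z"
    by (intro normal_function_group additive_subgroup_cocycles additive_subgroup_coboundaries
        coboundaries_subset_cocycles_3)
  have c: "f \<in> carrier (function_group ?Z)" "g \<in> carrier (function_group ?Z)"
    using f g by (auto simp: function_group_def)
  have "inv\<^bsub>cohomology G 3\<^esub> coh_class G 3 g = coh_class G 3 (\<lambda>x. - g x)"
    using coh_class_in_cohomology[OF g] rcos_inv[OF c(2)] inv_FactGroup
      inv_function_group[OF additive_subgroup_cocycles g]
    unfolding cohomology_def by (simp add: coh_class_def)
  then show ?thesis
    using rcos_sum[OF c(1), of "\<lambda>x. - g x"]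
      additive_subgroup_uminus[OF additive_subgroup_cocycles g]
    unfolding cohomology_def coh_class_def by (simp add: function_group_def)
qed

end


section \<open>Functoriality\<close>

text \<open>Membership in \<open>hom\<close> does not include preservation of the unit, but
  normalisation of the pullback depends on it; hence the separate assumption here and below.\<close>

lemma pullback_cochains:
  assumes "\<phi> \<in> hom H G" "\<phi> \<one>\<^bsub>H\<^esub> = \<one>\<^bsub>G\<^esub>" and f: "f \<in> cochains G s"
  shows "pullback H \<phi> f \<in> cochains H s"
  unfolding cochains_def
proof (intro CollectI allI impI)
  fix hs assume nz: "pullback H \<phi> f hs \<noteq> 0"
  then have hs: "set hs \<subseteq> carrier H" "f (map \<phi> hs) \<noteq> 0"
    by (auto simp: pullback_def split: if_splits)
  then have "int (length (map \<phi> hs)) = s" "\<one>\<^bsub>G\<^esub> \<notin> set (map \<phi> hs)"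
    using cochainsD[OF f, of "map \<phi> hs"] by blast+
  then show "int (length hs) = s \<and> set hs \<subseteq> carrier H - {\<one>\<^bsub>H\<^esub>}"
    using hs(1) assms(2) by (auto simp: image_iff)
qed

lemma pullback_add: "pullback H \<phi> (\<lambda>x. f x + g x) = (\<lambda>x. pullback H \<phi> f x + pullback H \<phi> g x)"
  by (rule ext) (simp add: pullback_def)

lemma pullback_diff: "pullback H \<phi> (\<lambda>x. f x - g x) = (\<lambda>x. pullback H \<phi> f x - pullback H \<phi> g x)"
  by (rule ext) (simp add: pullback_def)

lemma pullback_zero: "pullback H \<phi> (\<lambda>_. 0) = (\<lambda>_. 0)"
  by (rule ext) (simp add: pullback_def)

lemma coboundary_pullback:
  assumes H: "monoid H" and \<phi>: "\<phi> \<in> hom H G"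
  shows "coboundary H (pullback H \<phi> f) = pullback H \<phi> (coboundary G f)"
proof
  fix hs
  interpret H: monoid H by (rule H)
  show "coboundary H (pullback H \<phi> f) hs = pullback H \<phi> (coboundary G f) hs"
  proof (cases "hs \<noteq> [] \<and> set hs \<subseteq> carrier H")
    case True
    then have hs: "hs \<noteq> []" "set hs \<subseteq> carrier H" by auto
    have im: "\<phi> ` set hs \<subseteq> carrier G"
      using hs(2) \<phi> by (auto simp: hom_def)
    have tl: "set (tl hs) \<subseteq> carrier H" "set (butlast hs) \<subseteq> carrier H"
      using hs by (auto dest: list.set_sel(2) in_set_butlastD)
    have step: "pullback H \<phi> f (take i hs @ (hs ! i \<otimes>\<^bsub>H\<^esub> hs ! Suc i) # drop (i + 2) hs) =
        f (take i (map \<phi> hs) @ (map \<phi> hs ! i \<otimes>\<^bsub>G\<^esub> map \<phi> hs ! Suc i) # drop (i + 2) (map \<phi> hs))"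
      if i: "i < length hs - 1" for i
    proof -
      have "hs ! i \<in> carrier H" "hs ! Suc i \<in> carrier H"
        using i hs(2) by (auto simp: subset_iff)
      moreover have "set (take i hs) \<subseteq> carrier H" "set (drop (i + 2) hs) \<subseteq> carrier H"
        using hs(2) set_take_subset[of i hs] set_drop_subset[of "i + 2" hs] by auto
      ultimately show ?thesis
        using i \<phi> by (simp add: pullback_def take_map drop_map hom_mult)
    qed
    have "coboundary H (pullback H \<phi> f) hs = coboundary G f (map \<phi> hs)"
      using hs im tl step by (simp add: coboundary_def pullback_def[of H \<phi> f "tl hs"]
          pullback_def[of H \<phi> f "butlast hs"] map_tl map_butlast)
    then show ?thesis
      using hs by (simp add: pullback_def)
  qed (auto simp: coboundary_def pullback_def)
qed

lemma pullback_coboundaries: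
  assumes "monoid H" "\<phi> \<in> hom H G" "\<phi> \<one>\<^bsub>H\<^esub> = \<one>\<^bsub>G\<^esub>" and f: "f \<in> coboundaries G s"
  shows "pullback H \<phi> f \<in> coboundaries H s"
proof -
  obtain h where "h \<in> cochains G (s - 1)" "f = coboundary G h"
    using f by (auto simp: coboundaries_def)
  then show ?thesis
    unfolding coboundaries_def using pullback_cochains[OF assms(2,3)]
    by (intro image_eqI[of _ _ "pullback H \<phi> h"]) (auto simp: coboundary_pullback[OF assms(1,2)])
qed

lemma pullback_class_eqI:
  assumes "f \<in> u"
    and "\<And>g. g \<in> u \<Longrightarrow> coh_class H s (pullback H \<phi> g) = coh_class H s (pullback H \<phi> f)"
  shows "pullback_class H \<phi> s u = coh_class H s (pullback H \<phi> f)"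
  using assms unfolding pullback_class_def by (intro SUP_eq_const) blast+

lemma pullback_class_coh_class:
  assumes "monoid H" "\<phi> \<in> hom H G" "\<phi> \<one>\<^bsub>H\<^esub> = \<one>\<^bsub>G\<^esub>"
  shows "pullback_class H \<phi> s (coh_class G s f) = coh_class H s (pullback H \<phi> f)"
proof -
  have "coh_class H s (pullback H \<phi> g) = coh_class H s (pullback H \<phi> f)"
    if "g \<in> coh_class G s f" for g
    using that pullback_coboundaries[OF assms, of "\<lambda>x. g x - f x" s]
    by (intro coh_class_eqI) (simp add: mem_coh_class pullback_diff)
  then show ?thesis
    by (rule pullback_class_eqI[OF coh_class_self])
qed

text \<open>The homotopy \<open>h\<close> is the prism operator of conjugation by \<open>t\<close>.\<close>

lemma pullback_conjugate:
  assumes G: "monoid G" and M: "monoid M"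
    and \<iota>: "\<iota> \<in> hom M G" "\<iota> \<one>\<^bsub>M\<^esub> = \<one>\<^bsub>G\<^esub>" and \<psi>: "\<psi> \<in> hom M M" "\<psi> \<one>\<^bsub>M\<^esub> = \<one>\<^bsub>M\<^esub>"
    and t: "t \<in> carrier G"
    and conj: "\<And>m. m \<in> carrier M \<Longrightarrow> \<iota> m \<otimes>\<^bsub>G\<^esub> t = t \<otimes>\<^bsub>G\<^esub> \<iota> (\<psi> m)"
    and w: "w \<in> cocycles G 3"
  shows "(\<lambda>ms. pullback M \<psi> (pullback M \<iota> w) ms - pullback M \<iota> w ms) \<in> coboundaries M 3"
proof -
  interpret G: monoid G by (rule G)
  interpret M: monoid M by (rule M)
  have w3: "w \<in> cochains G 3" and dw: "\<And>gs. coboundary G w gs = 0"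
    using w by (auto simp: cocycles_def)
  define h where "h ms = (if length ms = 2 \<and> set ms \<subseteq> carrier M then
      let a = \<iota> (ms ! 0); b = \<iota> (ms ! 1); a' = \<iota> (\<psi> (ms ! 0)); b' = \<iota> (\<psi> (ms ! 1))
      in w [t, a', b'] - w [a, t, b'] + w [a, b, t] else 0)" for ms
  have hom: "\<iota> (x \<otimes>\<^bsub>M\<^esub> y) = \<iota> x \<otimes>\<^bsub>G\<^esub> \<iota> y" "\<psi> (x \<otimes>\<^bsub>M\<^esub> y) = \<psi> x \<otimes>\<^bsub>M\<^esub> \<psi> y"
    if "x \<in> carrier M" "y \<in> carrier M" for x y
    using that \<iota> \<psi> by (auto simp: hom_def)
  have cl: "\<iota> x \<in> carrier G" "\<psi> x \<in> carrier M" if "x \<in> carrier M" for x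
    using that \<iota> \<psi> by (auto simp: hom_def)
  have h: "h \<in> cochains M 2"
    by (rule cochains_2I) (auto simp: h_def Let_def \<iota> \<psi> cochains_one[OF w3])
  moreover have "(\<lambda>ms. pullback M \<psi> (pullback M \<iota> w) ms - pullback M \<iota> w ms) = coboundary M h"
  proof (rule cochains_eqI)
    show "(\<lambda>ms. pullback M \<psi> (pullback M \<iota> w) ms - pullback M \<iota> w ms) \<in> cochains M 3"
      by (intro cochains_diff pullback_cochains[OF \<psi>] pullback_cochains[OF \<iota>] w3)
    show "coboundary M h \<in> cochains M 3"
      by (rule M.coboundary_cochains_2[OF h])
    fix ms assume "int (length ms) = 3" "set ms \<subseteq> carrier M"
    then obtain a b c where ms: "ms = [a, b, c]" and abc: "a \<in> carrier M" "b \<in> carrier M" "c \<in> carrier M"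
      using length_3_conv[of ms] by auto
    \<comment> \<open>The cocycle identity with \<open>t\<close> inserted at each of the four
      positions. Terms in which \<open>t\<close> is multiplied by a neighbour cancel in pairs, since
      \<open>conj\<close> moves \<open>t\<close> past an element of \<open>M\<close>.\<close>
    have "w [\<iota> (\<psi> a), \<iota> (\<psi> b), \<iota> (\<psi> c)] - w [\<iota> a, \<iota> b, \<iota> c] - coboundary M h [a, b, c] =
        coboundary G w [t, \<iota> (\<psi> a), \<iota> (\<psi> b), \<iota> (\<psi> c)] - coboundary G w [\<iota> a, t, \<iota> (\<psi> b), \<iota> (\<psi> c)]
        + coboundary G w [\<iota> a, \<iota> b, t, \<iota> (\<psi> c)] - coboundary G w [\<iota> a, \<iota> b, \<iota> c, t]"
      using abc t by (simp add: coboundary_4 coboundary_3 h_def Let_def hom cl conj)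
    then have "w [\<iota> (\<psi> a), \<iota> (\<psi> b), \<iota> (\<psi> c)] - w [\<iota> a, \<iota> b, \<iota> c] = coboundary M h [a, b, c]"
      by (simp add: dw)
    then show "pullback M \<psi> (pullback M \<iota> w) ms - pullback M \<iota> w ms = coboundary M h ms"
      using abc by (simp add: ms pullback_def cl)
  qed
  ultimately show ?thesis
    by (auto simp: coboundaries_def)
qed


section \<open>The edge of the spectral sequence\<close>

lemma additive_subgroup_lhs_filtration: "additive_subgroup (lhs_filtration G N r m)"
  using additive_subgroup_cochains[of G m] by (auto simp: additive_subgroup_def lhs_filtration_def)

text \<open>For such \<open>r\<close> the vanishing condition concerns lists with more than
  \<open>m\<close> entries, on which an \<open>m\<close>-cochain is zero anyway.\<close>

lemma lhs_filtration_nonpos: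
  "r \<le> 0 \<Longrightarrow> lhs_filtration G N r m = (cochains G m :: ('g list \<Rightarrow> 'r::comm_ring_1) set)"
proof -
  assume r: "r \<le> 0"
  have "f gs = 0" if f: "f \<in> cochains G m" and l: "m - r + 1 \<le> int (length (filter (\<lambda>g. g \<in> N) gs))"
    for f :: "'g list \<Rightarrow> 'r" and gs
  proof (rule cochainsD[OF f])
    have "length (filter (\<lambda>g. g \<in> N) gs) \<le> length gs" by simp
    then show "\<not> (int (length gs) = m \<and> set gs \<subseteq> carrier G - {\<one>\<^bsub>G\<^esub>})"
      using l r by linarith
  qed
  then show ?thesis by (auto simp: lhs_filtration_def)
qed

lemma lhs_filtration_zero [simp]: "(\<lambda>_. 0) \<in> lhs_filtration G N r m"
  by (simp add: lhs_filtration_def)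

lemma lhs_Z_zero [simp]: "(\<lambda>_. 0) \<in> lhs_Z G N k r s"
  by (simp add: lhs_Z_def)

lemma additive_subgroup_lhs_Z: "additive_subgroup (lhs_Z G N k r s)"
  using additive_subgroup_lhs_filtration[of G N r "r + s"]
    additive_subgroup_lhs_filtration[of G N "r + k" "r + s + 1"]
  by (auto simp: additive_subgroup_def lhs_Z_def coboundary_diff)

lemma additive_subgroup_lhs_B:
  "additive_subgroup (lhs_B G N k r s :: ('g list \<Rightarrow> 'r::comm_ring_1) set)"
  unfolding additive_subgroup_def
proof (intro conjI ballI)
  let ?Z1 = "lhs_Z G N (k - 1) (r + 1) (s - 1) :: ('g list \<Rightarrow> 'r) set"
    and ?Z2 = "lhs_Z G N (k - 1) (r - k + 1) (s + k - 2) :: ('g list \<Rightarrow> 'r) set"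
  have Z: "additive_subgroup ?Z1" "additive_subgroup ?Z2"
    by (rule additive_subgroup_lhs_Z)+
  show "(\<lambda>_. 0 :: 'r) \<in> lhs_B G N k r s"
    unfolding lhs_B_def by (intro CollectI exI[of _ "\<lambda>_. 0"]) simp
  fix u v :: "'g list \<Rightarrow> 'r" assume "u \<in> lhs_B G N k r s" "v \<in> lhs_B G N k r s"
  then obtain f h f' h' where
    "u = (\<lambda>gs. f gs + coboundary G h gs)" "f \<in> ?Z1" "h \<in> ?Z2"
    "v = (\<lambda>gs. f' gs + coboundary G h' gs)" "f' \<in> ?Z1" "h' \<in> ?Z2"
    unfolding lhs_B_def by auto
  then show "(\<lambda>x. u x - v x) \<in> lhs_B G N k r s"
    using Z unfolding lhs_B_def additive_subgroup_def
    by (intro CollectI exI[of _ "\<lambda>x. f x - f' x"] exI[of _ "\<lambda>x. h x - h' x"])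
       (simp add: coboundary_diff fun_eq_iff)
qed

text \<open>At filtration degree 1 the threshold is \<open>s\<close> arguments in the subgroup, that
  is, all of them. Together with \<open>filtration_1I\<close> this identifies the first filtration
  step with the kernel of restriction to \<open>M\<close>.\<close>

lemma pullback_filtration_1:
  assumes "f \<in> lhs_filtration G (\<iota> ` carrier M) 1 s"
  shows "pullback M \<iota> f = (\<lambda>_. 0)"
proof
  fix ms
  have f: "f \<in> cochains G s" "\<And>gs. int (length (filter (\<lambda>g. g \<in> \<iota> ` carrier M) gs)) \<ge> s \<Longrightarrow> f gs = 0"
    using assms by (auto simp: lhs_filtration_def)
  show "pullback M \<iota> f ms = 0"
  proof (cases "int (length ms) = s \<and> set ms \<subseteq> carrier M")
    case True
    then have "filter (\<lambda>g. g \<in> \<iota> ` carrier M) (map \<iota> ms) = map \<iota> ms"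
      by (auto simp: filter_id_conv)
    then show ?thesis
      using f(2)[of "map \<iota> ms"] True by (simp add: pullback_def)
  next
    case False
    then show ?thesis
      using cochainsD[OF f(1), of "map \<iota> ms"] by (auto simp: pullback_def)
  qed
qed

lemma filtration_1I:
  assumes f: "f \<in> cochains G s" and "pullback M \<iota> f = (\<lambda>_. 0)"
  shows "f \<in> lhs_filtration G (\<iota> ` carrier M) 1 s"
proof -
  have "f gs = 0" if l: "s \<le> int (length (filter (\<lambda>g. g \<in> \<iota> ` carrier M) gs))" for gs
  proof (cases "int (length gs) = s")
    case True
    then have "length (filter (\<lambda>g. g \<in> \<iota> ` carrier M) gs) = length gs"
      using l length_filter_le[of "\<lambda>g. g \<in> \<iota> ` carrier M" gs] by linarith
    then have "set gs \<subseteq> \<iota> ` carrier M"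
      by (metis length_filter_less less_irrefl subsetI)
    then obtain ms where "gs = map \<iota> ms" "set ms \<subseteq> carrier M"
      by (intro that[of "map (inv_into (carrier M) \<iota>) gs"])
         (auto simp: map_idI f_inv_into_f subset_iff inv_into_into)
    then show ?thesis
      using fun_cong[OF assms(2), of ms] by (simp add: pullback_def)
  qed (use cochainsD[OF f] in auto)
  then show ?thesis
    using f by (simp add: lhs_filtration_def)
qed

text \<open>Extension by zero to lists that leave the image of \<open>M\<close>. Injectivity of
  \<open>\<iota>\<close> gives both that the extension restricts to \<open>h\<close> and that it is
  normalised, the unit having the unit as its chosen preimage.\<close>

lemma pullback_extension:
  assumes \<iota>: "\<iota> \<in> hom M G" "\<iota> \<one>\<^bsub>M\<^esub> = \<one>\<^bsub>G\<^esub>" "inj_on \<iota> (carrier M)" "\<one>\<^bsub>M\<^esub> \<in> carrier M"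
    and h: "h \<in> cochains M s"
  obtains h' where "h' \<in> cochains G s" "pullback M \<iota> h' = h"
proof
  let ?h = "\<lambda>gs. if set gs \<subseteq> \<iota> ` carrier M then h (map (inv_into (carrier M) \<iota>) gs) else 0"
  show "?h \<in> cochains G s"
    unfolding cochains_def
  proof (intro CollectI allI impI)
    fix gs assume "?h gs \<noteq> 0"
    then have gs: "set gs \<subseteq> \<iota> ` carrier M" and nz: "h (map (inv_into (carrier M) \<iota>) gs) \<noteq> 0"
      by (auto split: if_splits)
    have "int (length gs) = s" "\<one>\<^bsub>M\<^esub> \<notin> set (map (inv_into (carrier M) \<iota>) gs)"
      using cochainsD[OF h, of "map (inv_into (carrier M) \<iota>) gs"] nz by auto
    moreover have "inv_into (carrier M) \<iota> \<one>\<^bsub>G\<^esub> = \<one>\<^bsub>M\<^esub>"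
      using \<iota> inv_into_f_f by metis
    ultimately show "int (length gs) = s \<and> set gs \<subseteq> carrier G - {\<one>\<^bsub>G\<^esub>}"
      using gs \<iota>(1) by (auto simp: hom_def image_iff)
  qed
  show "pullback M \<iota> ?h = h"
  proof
    fix ms
    show "pullback M \<iota> ?h ms = h ms"
    proof (cases "set ms \<subseteq> carrier M")
      case True
      then have "map (inv_into (carrier M) \<iota> \<circ> \<iota>) ms = ms"
        using \<iota>(3) by (intro map_idI) auto
      then show ?thesis
        using True by (auto simp: pullback_def)
    next
      case False
      then show ?thesis
        using cochainsD[OF h, of ms] by (auto simp: pullback_def)
    qed
  qed
qed

text \<open>
  Elements of \<open>E\<^sub>2\<^sup>0\<^sup>,\<^sup>3\<close> with equal restriction to \<open>M\<close> are equal
  because a cochain of \<open>M\<close> that bounds the difference extends to \<open>G\<close>.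
\<close>

lemma lhs_edge_cocycle:
  fixes w :: "'g list \<Rightarrow> 'r::comm_ring_1"
  assumes G: "monoid G" and M: "monoid M"
    and \<iota>: "\<iota> \<in> hom M G" "\<iota> \<one>\<^bsub>M\<^esub> = \<one>\<^bsub>G\<^esub>" "inj_on \<iota> (carrier M)"
    and w: "w \<in> cocycles G 3"
  defines "N \<equiv> \<iota> ` carrier M" and "u \<equiv> coh_class M 3 (pullback M \<iota> w)"
  shows "\<exists>!\<xi>. \<xi> \<in> carrier (lhs_E G N 2 0 3) \<and> pullback_class M \<iota> 3 \<xi> = u"
    and "\<lbrakk>\<xi> \<in> carrier (lhs_E G N 2 0 3); pullback_class M \<iota> 3 \<xi> = u\<rbrakk>
           \<Longrightarrow> lhs_d G N 2 0 3 \<xi> = \<one>\<^bsub>lhs_E G N 2 2 2\<^esub>"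
proof -
  interpret G: monoid G by (rule G)
  interpret M: monoid M by (rule M)
  let ?B = "lhs_B G N 2 0 3 :: ('g list \<Rightarrow> 'r) set" and ?Z = "lhs_Z G N 2 0 3 :: ('g list \<Rightarrow> 'r) set"
  let ?c = "\<lambda>f. ?B #>\<^bsub>function_group ?Z\<^esub> f"
  have E: "carrier (lhs_E G N 2 0 3) = ?c ` ?Z"
    by (auto simp: lhs_E_def FactGroup_def RCOSETS_def function_group_def)
  have addB: "additive_subgroup (lhs_B G N k r s :: ('g list \<Rightarrow> 'r) set)" for k r s
    by (rule additive_subgroup_lhs_B)
  have Zw: "w \<in> ?Z"
    using w by (simp add: lhs_Z_def cocycles_def lhs_filtration_nonpos)
  have Z1: "b \<in> lhs_Z G N 1 1 2 \<longleftrightarrow> b \<in> cochains G 3 \<and> pullback M \<iota> b = (\<lambda>_. 0) \<and>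
      coboundary G b \<in> lhs_filtration G N 2 4" for b :: "'g list \<Rightarrow> 'r"
    using filtration_1I[of b G 3 M \<iota>] pullback_filtration_1[of b G \<iota> M 3]
    by (auto simp: lhs_Z_def N_def lhs_filtration_def)
  \<comment> \<open>Filtration degrees -1 and 0 impose no condition, so the second summand of
    \<open>B_2^{0,3}\<close> consists of the coboundaries of all 2-cochains of
    \<open>G\<close>.\<close>
  have Z2: "lhs_Z G N 1 (-1) 3 = (cochains G 2 :: ('g list \<Rightarrow> 'r) set)"
    using G.coboundary_cochains_2 by (auto simp: lhs_Z_def lhs_filtration_nonpos)
  have B: "f \<in> ?B \<longleftrightarrow> (\<exists>b h. f = (\<lambda>gs. b gs + coboundary G h gs) \<and> b \<in> lhs_Z G N 1 1 2 \<and> h \<in> cochains G 2)"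
    for f
    by (simp add: lhs_B_def Z2)
  have restrict_B: "pullback M \<iota> f \<in> coboundaries M 3" if fB: "f \<in> ?B" for f
  proof -
    obtain b h where f: "f = (\<lambda>gs. b gs + coboundary G h gs)" "b \<in> lhs_Z G N 1 1 2" "h \<in> cochains G 2"
      using fB unfolding B by blast
    have "pullback M \<iota> f = coboundary M (pullback M \<iota> h)"
      using f(2) by (simp add: f(1) pullback_add Z1 coboundary_pullback[OF M \<iota>(1)])
    then show ?thesis
      using pullback_cochains[OF \<iota>(1,2) f(3)] by (simp add: coboundaries_def)
  qed
  have edge: "pullback_class M \<iota> 3 (?c f) = coh_class M 3 (pullback M \<iota> f)" for f
  proof -
    have "coh_class M 3 (pullback M \<iota> g) = coh_class M 3 (pullback M \<iota> f)" if g: "g \<in> ?c f" for g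
    proof (rule coh_class_eqI)
      have "(\<lambda>x. g x - f x) \<in> ?B"
        using g by (simp only: mem_coset_iff)
      from restrict_B[OF this] show "(\<lambda>x. pullback M \<iota> g x - pullback M \<iota> f x) \<in> coboundaries M 3"
        by (simp only: pullback_diff)
    qed
    then show ?thesis
      by (rule pullback_class_eqI[OF coset_self[OF addB]])
  qed
  have edge_inj: "(\<lambda>x. f x - w x) \<in> ?B" if f: "f \<in> ?Z" and eq: "pullback_class M \<iota> 3 (?c f) = u" for f
  proof -
    have "(\<lambda>x. pullback M \<iota> f x - pullback M \<iota> w x) \<in> coboundaries M 3"
      using eq by (simp add: edge u_def coh_class_eq_iff)
    then obtain h where h: "h \<in> cochains M 2"
      "(\<lambda>x. pullback M \<iota> f x - pullback M \<iota> w x) = coboundary M h"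
      by (auto simp: coboundaries_def)
    obtain h' where h': "h' \<in> cochains G 2" "pullback M \<iota> h' = h"
      using pullback_extension[OF \<iota> _ h(1)] by auto
    \<comment> \<open>Subtracting the coboundary of the extended cochain makes the restriction to
      \<open>M\<close> vanish and leaves the coboundary equal to that of \<open>f\<close>. So
      \<open>?b\<close> lies in \<open>Z_1^{1,2}\<close>, and \<open>f - w\<close> is written as an
      element of \<open>B_2^{0,3}\<close>.\<close>
    let ?b = "\<lambda>x. (f x - w x) - coboundary G h' x"
    have "pullback M \<iota> ?b = (\<lambda>_. 0)"
      using h(2) by (simp add: pullback_diff h' flip: coboundary_pullback[OF M \<iota>(1)])
    moreover have "coboundary G ?b = coboundary G f"
      using w by (simp add: coboundary_diff G.coboundary_coboundary_2[OF h'(1)] cocycles_def)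
    moreover have f': "f \<in> cochains G 3" "coboundary G f \<in> lhs_filtration G N 2 4"
      using f by (simp_all add: lhs_Z_def lhs_filtration_nonpos)
    moreover have "?b \<in> cochains G 3"
      using w by (intro cochains_diff f' G.coboundary_cochains_2[OF h'(1)]) (simp add: cocycles_def)
    ultimately have "?b \<in> lhs_Z G N 1 1 2"
      by (simp only: Z1)
    then show ?thesis
      unfolding B using h'(1) by (intro exI[of _ ?b] exI[of _ h']) simp
  qed
  have unique: "\<xi> = ?c w" if \<xi>: "\<xi> \<in> carrier (lhs_E G N 2 0 3)" "pullback_class M \<iota> 3 \<xi> = u" for \<xi>
  proof -
    obtain f where f: "\<xi> = ?c f" "f \<in> ?Z"
      using \<xi>(1) unfolding E by blast
    then show ?thesis
      using edge_inj[of f] \<xi>(2) by (simp add: coset_eqI[OF addB])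
  qed
  show "\<exists>!\<xi>. \<xi> \<in> carrier (lhs_E G N 2 0 3) \<and> pullback_class M \<iota> 3 \<xi> = u"
  proof (rule ex1I)
    show "?c w \<in> carrier (lhs_E G N 2 0 3) \<and> pullback_class M \<iota> 3 (?c w) = u"
      using Zw by (auto simp: E edge u_def)
  qed (use unique in blast)
  assume "\<xi> \<in> carrier (lhs_E G N 2 0 3)" "pullback_class M \<iota> 3 \<xi> = u"
  then have \<xi>: "\<xi> = ?c w" by (rule unique)
  let ?B' = "lhs_B G N 2 2 2 :: ('g list \<Rightarrow> 'r) set"
  \<comment> \<open>Any other representative differs from \<open>w\<close> by
    \<open>b + \<delta>h\<close> with \<open>b\<close> in \<open>Z_1^{1,2}\<close>, so its
    coboundary is that of \<open>b\<close>. The coboundaries of \<open>Z_1^{1,2}\<close> are divided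
    out in the target, being the second summand of \<open>B_2^{2,2}\<close>.\<close>
  have \<delta>: "coboundary G f \<in> ?B'" if f\<xi>: "f \<in> \<xi>" for f
  proof -
    obtain b h where f: "(\<lambda>x. f x - w x) = (\<lambda>gs. b gs + coboundary G h gs)"
      and b: "b \<in> lhs_Z G N 1 1 2" and h: "h \<in> cochains G 2"
      using f\<xi> unfolding \<xi> mem_coset_iff B by blast
    have "f = (\<lambda>gs. (b gs + coboundary G h gs) + w gs)"
      using fun_cong[OF f] by (auto simp: fun_eq_iff algebra_simps)
    then have "coboundary G f = coboundary G b"
      using w by (simp add: coboundary_add G.coboundary_coboundary_2[OF h] cocycles_def)
    then show ?thesis
      using b unfolding lhs_B_def by (intro CollectI exI[of _ "\<lambda>_. 0"] exI[of _ b]) simp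
  qed
  have "lhs_d G N 2 0 3 \<xi> = (\<Union>f\<in>\<xi>. ?B')"
    unfolding lhs_d_def by (intro SUP_cong refl) (simp add: coset_absorb[OF addB \<delta>])
  \<comment> \<open>\<open>lhs_d\<close> is a union over \<open>\<xi>\<close>; a member is needed to
    exclude the empty union.\<close>
  moreover have "w \<in> \<xi>"
    unfolding \<xi> by (rule coset_self[OF addB])
  ultimately have "lhs_d G N 2 0 3 \<xi> = ?B'"
    by auto
  then show "lhs_d G N 2 0 3 \<xi> = \<one>\<^bsub>lhs_E G N 2 2 2\<^esub>"
    by (simp add: lhs_E_def FactGroup_def)
qed


section \<open>Cup products\<close>

lemma cup_cochain_cochains:
  assumes f: "f \<in> cochains G s" and g: "g \<in> cochains G t" and "s \<ge> 0" "t \<ge> 0"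
  shows "cup_cochain s f g \<in> cochains G (s + t)"
  unfolding cochains_def
proof (intro CollectI allI impI)
  fix gs assume "cup_cochain s f g gs \<noteq> 0"
  then have "f (take (nat s) gs) \<noteq> 0" "g (drop (nat s) gs) \<noteq> 0"
    by (auto simp: cup_cochain_def)
  then have *: "int (length (take (nat s) gs)) = s \<and> set (take (nat s) gs) \<subseteq> carrier G - {\<one>\<^bsub>G\<^esub>}"
      "int (length (drop (nat s) gs)) = t \<and> set (drop (nat s) gs) \<subseteq> carrier G - {\<one>\<^bsub>G\<^esub>}"
    using cochainsD[OF f] cochainsD[OF g] by metis+
  have "int (length gs) = int (length (take (nat s) gs)) + int (length (drop (nat s) gs))"
    by (simp flip: of_nat_add)
  moreover have "set gs = set (take (nat s) gs) \<union> set (drop (nat s) gs)"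
    by (metis append_take_drop_id set_append)
  ultimately show "int (length gs) = s + t \<and> set gs \<subseteq> carrier G - {\<one>\<^bsub>G\<^esub>}"
    using * by auto
qed

lemma cup_cochain_1: "cup_cochain 1 f g (a # gs) = f [a] * g gs"
  by (simp add: cup_cochain_def)

lemma cup_cochain_2: "cup_cochain 2 f g (a # b # gs) = f [a, b] * g gs"
  by (simp add: cup_cochain_def numeral_2_eq_2)

lemma cocycles_1_mult:
  assumes "f \<in> cocycles G 1" "a \<in> carrier G" "b \<in> carrier G"
  shows "f [a \<otimes>\<^bsub>G\<^esub> b] = f [a] + f [b]"
proof -
  have "coboundary G f [a, b] = 0"
    using assms(1) by (simp add: cocycles_def)
  then show ?thesis
    using assms(2,3) by (simp add: coboundary_2 algebra_simps)
qed

context monoid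
begin

text \<open>The Leibniz rule for 1-cochains that need not be cocycles. It is used for changing
  representatives of a cup product and for computing the Bockstein of a product over the
  integers.\<close>

lemma coboundary_cup_1_1:
  assumes f: "f \<in> cochains G 1" and h: "h \<in> cochains G 1"
  shows "coboundary G (cup_cochain 1 f h) =
    (\<lambda>gs. cup_cochain 2 (coboundary G f) h gs - cup_cochain 1 f (coboundary G h) gs)"
proof (rule cochains_eqI)
  show "coboundary G (cup_cochain 1 f h) \<in> cochains G 3"
    using cup_cochain_cochains[OF f h] by (intro coboundary_cochains_2) simp
  show "(\<lambda>gs. cup_cochain 2 (coboundary G f) h gs - cup_cochain 1 f (coboundary G h) gs) \<in> cochains G 3"
    using cup_cochain_cochains[OF coboundary_cochains_1[OF f] h]
      cup_cochain_cochains[OF f coboundary_cochains_1[OF h]]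
    by (intro cochains_diff) simp_all
  fix gs assume "int (length gs) = 3" "set gs \<subseteq> carrier G"
  then obtain a b c where gs: "gs = [a, b, c]" and "a \<in> carrier G" "b \<in> carrier G" "c \<in> carrier G"
    using length_3_conv[of gs] by auto
  then show "coboundary G (cup_cochain 1 f h) gs =
      cup_cochain 2 (coboundary G f) h gs - cup_cochain 1 f (coboundary G h) gs"
    by (simp add: gs coboundary_3 coboundary_2 cup_cochain_1 cup_cochain_2 algebra_simps)
qed

lemma cup_cocycles_1_2:
  assumes f: "f \<in> cocycles G 1" and g: "g \<in> cocycles G 2"
  shows "cup_cochain 1 f g \<in> cocycles G 3"
proof -
  have f1: "f \<in> cochains G 1" and g2: "g \<in> cochains G 2" and dg: "\<And>gs. coboundary G g gs = 0"
    using f g by (auto simp: cocycles_def)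
  have c: "cup_cochain 1 f g \<in> cochains G 3"
    using cup_cochain_cochains[OF f1 g2] by simp
  have "coboundary G (cup_cochain 1 f g) gs = 0" for gs
  proof (cases "length gs = 4 \<and> set gs \<subseteq> carrier G")
    case True
    then obtain a b c d where gs: "gs = [a, b, c, d]"
      and cl: "a \<in> carrier G" "b \<in> carrier G" "c \<in> carrier G" "d \<in> carrier G"
      by (auto simp: length_4_conv)
    have "coboundary G (cup_cochain 1 f g) gs = - (f [a] * coboundary G g [b, c, d])"
      using cl by (simp add: gs coboundary_4 coboundary_3 cup_cochain_1 cocycles_1_mult[OF f] algebra_simps)
    then show ?thesis by (simp add: dg)
  next
    case False
    then show ?thesis
      using coboundary_outside[OF c, of gs] by auto
  qed
  then show ?thesis
    using c by (auto simp: cocycles_def)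
qed

text \<open>\<open>cup\<close> is a union over all pairs of representatives. The first one is unique
  in degree 1, and replacing \<open>g\<close> by \<open>g + \<delta>h\<close> changes the product by
  \<open>f \<union> \<delta>h = - \<delta>(f \<union> h)\<close>, so all pairs give the same
  coset.\<close>

lemma cup_coh_class_1_2:
  assumes f: "f \<in> cocycles G 1"
  shows "cup G 1 2 (coh_class G 1 f) (coh_class G 2 g) = coh_class G 3 (cup_cochain 1 f g)"
proof -
  have f1: "f \<in> cochains G 1" and df: "coboundary G f = (\<lambda>_. 0)"
    using f by (auto simp: cocycles_def)
  have eq: "coh_class G 3 (cup_cochain 1 f g') = coh_class G 3 (cup_cochain 1 f g)"
    if g': "g' \<in> coh_class G 2 g" for g'
  proof (rule coh_class_eqI)
    obtain h where h: "h \<in> cochains G 1" "(\<lambda>x. g' x - g x) = coboundary G h"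
      using g' by (auto simp: mem_coh_class coboundaries_def)
    have "(\<lambda>gs. cup_cochain 1 f g' gs - cup_cochain 1 f g gs) = cup_cochain 1 f (coboundary G h)"
      unfolding h(2)[symmetric] by (rule ext) (simp add: cup_cochain_def algebra_simps)
    also have "\<dots> = coboundary G (\<lambda>gs. - cup_cochain 1 f h gs)"
      unfolding coboundary_uminus coboundary_cup_1_1[OF f1 h(1)] df
      by (rule ext) (simp add: cup_cochain_def)
    finally show "(\<lambda>gs. cup_cochain 1 f g' gs - cup_cochain 1 f g gs) \<in> coboundaries G 3"
      using cochains_uminus[OF cup_cochain_cochains[OF f1 h(1)]] by (simp add: coboundaries_def)
  qed
  have "cup G 1 2 (coh_class G 1 f) (coh_class G 2 g) =
      (\<Union>g' \<in> coh_class G 2 g. coh_class G 3 (cup_cochain 1 f g'))"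
    by (simp add: cup_def coh_class_1)
  also have "\<dots> = (\<Union>g' \<in> coh_class G 2 g. coh_class G 3 (cup_cochain 1 f g))"
    by (intro SUP_cong refl eq)
  also have "\<dots> = coh_class G 3 (cup_cochain 1 f g)"
    using coh_class_self[of g G 2] by auto
  finally show ?thesis .
qed

text \<open>The bounding cochain is Steenrod's product \<open>g \<union>\<^sub>1 f\<close>.\<close>

lemma cup_commute_1_2:
  assumes f: "f \<in> cocycles G 1" and g: "g \<in> cocycles G 2"
  shows "(\<lambda>gs. cup_cochain 2 g f gs - cup_cochain 1 f g gs) \<in> coboundaries G 3"
proof -
  have f1: "f \<in> cochains G 1" and g2: "g \<in> cochains G 2" and dg: "\<And>gs. coboundary G g gs = 0"
    using f g by (auto simp: cocycles_def)
  define h where "h gs = g gs * (f [gs ! 0] + f [gs ! 1])" for gs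
  have h: "h \<in> cochains G 2"
  proof (rule cochains_2I)
    show "h gs = 0" if "length gs \<noteq> 2 \<or> \<not> set gs \<subseteq> carrier G" for gs
    proof -
      have "g gs = 0"
        using that by (intro cochainsD[OF g2]) auto
      then show ?thesis by (simp add: h_def)
    qed
  qed (simp_all add: h_def cochains_one[OF g2])
  have "(\<lambda>gs. cup_cochain 2 g f gs - cup_cochain 1 f g gs) = coboundary G h"
  proof (rule cochains_eqI)
    show "(\<lambda>gs. cup_cochain 2 g f gs - cup_cochain 1 f g gs) \<in> cochains G 3"
      using cup_cochain_cochains[OF f1 g2] cup_cochain_cochains[OF g2 f1]
      by (intro cochains_diff) simp_all
    show "coboundary G h \<in> cochains G 3"
      by (rule coboundary_cochains_2[OF h])
    fix gs assume "int (length gs) = 3" "set gs \<subseteq> carrier G"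
    then obtain a b c where gs: "gs = [a, b, c]" and cl: "a \<in> carrier G" "b \<in> carrier G" "c \<in> carrier G"
      using length_3_conv[of gs] by auto
    \<comment> \<open>By additivity of \<open>f\<close> both inner terms of the coboundary carry the
      factor \<open>f [a] + f [b] + f [c]\<close>. Completing the two outer terms to this factor
      leaves exactly \<open>g [a, b] * f [c]\<close> and \<open>- f [a] * g [b, c]\<close>.\<close>
    have "coboundary G h gs = coboundary G g [a, b, c] * (f [a] + f [b] + f [c])
        + (cup_cochain 2 g f gs - cup_cochain 1 f g gs)"
      using cl by (simp add: gs coboundary_3 h_def cup_cochain_1 cup_cochain_2 cocycles_1_mult[OF f]
          algebra_simps)
    then show "cup_cochain 2 g f gs - cup_cochain 1 f g gs = coboundary G h gs"
      by (simp add: dg)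
  qed
  then show ?thesis
    using h by (simp add: coboundaries_def)
qed

end


section \<open>The group \<open>M\<close> and its Bockstein\<close>

lemma carrier_heis_M:
  "p > 0 \<Longrightarrow> carrier (heis_M p n) = {0..<int (p ^ n)} \<times> {0..<int (p ^ n)}"
  by (simp add: heis_M_def carrier_integer_mod_group)

lemma mult_heis_M:
  "(i, j) \<otimes>\<^bsub>heis_M p n\<^esub> (i', j') = ((i + i') mod int (p ^ n), (j + j') mod int (p ^ n))"
  by (simp add: heis_M_def)

lemma one_heis_M: "\<one>\<^bsub>heis_M p n\<^esub> = (0, 0)"
  by (simp add: heis_M_def)

lemma monoid_heis_M: "monoid (heis_M p n)"
  unfolding heis_M_def by (intro group.is_monoid DirProd_group) simp_all

lemma cochain_of_hom_cochains: "\<chi> \<one>\<^bsub>G\<^esub> = 0 \<Longrightarrow> cochain_of_hom G \<chi> \<in> cochains G 1"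
  by (rule cochains_1I) (auto simp: cochain_of_hom_def)

lemma cochain_of_hom_1: "a \<in> carrier G \<Longrightarrow> cochain_of_hom G \<chi> [a] = \<chi> a"
  by (simp add: cochain_of_hom_def)

text \<open>For a linear form \<open>\<chi>\<close> the division is exact, and the result represents the Bockstein of \<open>\<chi>\<close>.\<close>

definition heis_beta :: "nat \<Rightarrow> nat \<Rightarrow> (int \<times> int \<Rightarrow> int) \<Rightarrow> (int \<times> int) list \<Rightarrow> int" where
  "heis_beta p n \<chi> ms = coboundary (heis_M p n) (cochain_of_hom (heis_M p n) \<chi>) ms div int (p ^ n)"

context
  fixes p n :: nat and \<chi> :: "int \<times> int \<Rightarrow> int"
  assumes p: "prime p" and \<chi>: "\<exists>c d. \<chi> = (\<lambda>(i, j). c * i + d * j)"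
begin

lemma linear_cochains: "cochain_of_hom (heis_M p n) \<chi> \<in> cochains (heis_M p n) 1"
  using \<chi> by (intro cochain_of_hom_cochains) (auto simp: one_heis_M)

text \<open>On residues in \<open>{0..<p^n}\<close> a linear form fails to be additive only through
  the carries in the two coordinates, and each carry is a multiple of \<open>p^n\<close>.\<close>

lemma coboundary_linear:
  "coboundary (heis_M p n) (cochain_of_hom (heis_M p n) \<chi>) = (\<lambda>ms. int (p ^ n) * heis_beta p n \<chi> ms)"
proof
  interpret M: monoid "heis_M p n" by (rule monoid_heis_M)
  fix ms
  let ?\<delta> = "coboundary (heis_M p n) (cochain_of_hom (heis_M p n) \<chi>)"
  have "int (p ^ n) dvd ?\<delta> ms"
  proof (cases "length ms = 2 \<and> set ms \<subseteq> carrier (heis_M p n)")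
    case True
    then obtain a b where ms: "ms = [a, b]" and ab: "a \<in> carrier (heis_M p n)" "b \<in> carrier (heis_M p n)"
      by (auto simp: length_2_conv)
    obtain i j i' j' where ij: "a = (i, j)" "b = (i', j')" by (cases a, cases b)
    obtain c d where cd: "\<chi> = (\<lambda>(i, j). c * i + d * j)" using \<chi> by blast
    have "?\<delta> ms = \<chi> b - \<chi> (a \<otimes>\<^bsub>heis_M p n\<^esub> b) + \<chi> a"
      using ab M.m_closed[OF ab] by (simp add: ms coboundary_2 cochain_of_hom_1)
    also have "\<dots> = c * (i + i' - (i + i') mod int (p ^ n)) + d * (j + j' - (j + j') mod int (p ^ n))"
      by (simp add: ij cd mult_heis_M algebra_simps)
    also have "int (p ^ n) dvd \<dots>"
      by (intro dvd_add dvd_mult dvd_minus_mod)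
    finally show ?thesis .
  next
    case False
    then show ?thesis
      using coboundary_outside[OF linear_cochains, of ms] by auto
  qed
  then show "?\<delta> ms = int (p ^ n) * heis_beta p n \<chi> ms"
    by (simp add: heis_beta_def)
qed

text \<open>\<open>p^n\<close> times the coboundary is a double coboundary, hence zero, and
  \<open>p^n\<close> can be cancelled because the values are integers. The same argument later gives
  \<open>heis_nu_cocycles\<close>.\<close>

lemma heis_beta_cocycles: "heis_beta p n \<chi> \<in> cocycles (heis_M p n) 2"
proof -
  interpret M: monoid "heis_M p n" by (rule monoid_heis_M)
  have q: "int (p ^ n) \<noteq> 0" using p by (simp add: prime_gt_0_nat)
  have "(\<lambda>ms. int (p ^ n) * heis_beta p n \<chi> ms) \<in> cochains (heis_M p n) 2"
    using M.coboundary_cochains_1[OF linear_cochains] by (simp only: coboundary_linear)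
  then have "heis_beta p n \<chi> \<in> cochains (heis_M p n) 2"
    using q by (simp add: cochains_def)
  moreover have "(\<lambda>ms. int (p ^ n) * coboundary (heis_M p n) (heis_beta p n \<chi>) ms) = (\<lambda>_. 0)"
    using M.coboundary_coboundary_1[OF linear_cochains] by (simp only: coboundary_linear coboundary_mult)
  ultimately show ?thesis
    using q by (auto simp: cocycles_def fun_eq_iff)
qed

end

section \<open>Linear forms as integral lifts, and uniqueness of the Bockstein on
  \<open>M\<close>\<close>

lemma linear_fst: "\<exists>c d. fst = (\<lambda>(i, j). c * i + d * j :: int)"
  by (intro exI[of _ 1] exI[of _ 0]) auto

lemma linear_snd: "\<exists>c d. snd = (\<lambda>(i, j). c * i + d * j :: int)"
  by (intro exI[of _ 0] exI[of _ 1]) auto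

lemma cocycles_of_int:
  "x \<in> cocycles G s \<Longrightarrow> (\<lambda>gs. of_int (x gs) :: 'r::comm_ring_1) \<in> cocycles G s"
  by (simp add: cocycles_def cochains_of_int coboundary_of_int)

lemma of_int_power_CHAR:
  assumes "CHAR('k::field) = p" "n \<ge> 1"
  shows "of_int (int (p ^ n) * c) = (0 :: 'k)"
proof -
  have "int p dvd int (p ^ n)"
    using assms(2) by simp
  then show ?thesis
    using assms(1) by (simp only: of_int_eq_0_iff_char_dvd dvd_mult2)
qed

lemma linear_cocycles:
  fixes \<chi> :: "int \<times> int \<Rightarrow> int"
  assumes "prime p" "\<exists>c d. \<chi> = (\<lambda>(i, j). c * i + d * j)" "CHAR('k::field) = p" "n \<ge> 1"
  shows "(\<lambda>ms. of_int (cochain_of_hom (heis_M p n) \<chi> ms) :: 'k) \<in> cocycles (heis_M p n) 1"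
  unfolding cocycles_def
  by (simp only: mem_Collect_eq cochains_of_int[OF linear_cochains[OF assms(1,2)]] coboundary_of_int
      coboundary_linear[OF assms(1,2)] of_int_power_CHAR[OF assms(3,4)] simp_thms)

text \<open>Multiples of \<open>(1, 0)\<close> and \<open>(0, 1)\<close> with coefficients below
  \<open>p^n\<close>, and the sum of two such multiples, are formed without reduction modulo
  \<open>p^n\<close>. Additivity modulo \<open>r\<close> therefore propagates from the two
  generators by induction.\<close>

lemma additive_mod_linear:
  fixes z :: "(int \<times> int) list \<Rightarrow> int"
  assumes p: "prime p" and n: "n \<ge> 1" and z: "z \<in> cochains (heis_M p n) 1"
    and r: "\<And>ms. r dvd coboundary (heis_M p n) z ms"
    and ij: "(i, j) \<in> carrier (heis_M p n)"
  shows "r dvd z [(i, j)] - (z [(1, 0)] * i + z [(0, 1)] * j)"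
proof -
  let ?q = "int (p ^ n)"
  have p0: "p > 0" using p by (simp add: prime_gt_0_nat)
  have q1: "?q > 1"
    using p n by (metis less_le_trans of_nat_1 of_nat_less_iff one_less_power prime_gt_1_nat zero_less_one)
  note C = carrier_heis_M[OF p0]
  have z0: "z [(0, 0)] = 0"
    using cochains_one[OF z, of "[(0, 0)]"] by (simp add: one_heis_M)
  have add: "r dvd z [b] - z [a \<otimes>\<^bsub>heis_M p n\<^esub> b] + z [a]"
    if "a \<in> carrier (heis_M p n)" "b \<in> carrier (heis_M p n)" for a b
    using r[of "[a, b]"] that by (simp add: coboundary_2)
  have i: "r dvd z [(int k, 0)] - z [(1, 0)] * int k" if "int k < ?q" for k
    using that
  proof (induction k)
    case (Suc k)
    have "(int k, 0) \<otimes>\<^bsub>heis_M p n\<^esub> (1, 0) = (int (Suc k), 0)"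
      using Suc.prems by (simp add: mult_heis_M)
    then have d: "r dvd z [(1, 0)] - z [(int (Suc k), 0)] + z [(int k, 0)]"
      using add[of "(int k, 0)" "(1, 0)"] Suc.prems q1 p0 by (simp add: C)
    have "r dvd z [(int k, 0)] - z [(1, 0)] * int k"
      using Suc by simp
    from dvd_diff[OF this d] show ?case by (simp add: algebra_simps)
  qed (simp add: z0)
  have j: "r dvd z [(0, int k)] - z [(0, 1)] * int k" if "int k < ?q" for k
    using that
  proof (induction k)
    case (Suc k)
    have "(0, int k) \<otimes>\<^bsub>heis_M p n\<^esub> (0, 1) = (0, int (Suc k))"
      using Suc.prems by (simp add: mult_heis_M)
    then have d: "r dvd z [(0, 1)] - z [(0, int (Suc k))] + z [(0, int k)]"
      using add[of "(0, int k)" "(0, 1)"] Suc.prems q1 p0 by (simp add: C)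
    have "r dvd z [(0, int k)] - z [(0, 1)] * int k"
      using Suc by simp
    from dvd_diff[OF this d] show ?case by (simp add: algebra_simps)
  qed (simp add: z0)
  have ij': "0 \<le> i" "i < ?q" "0 \<le> j" "j < ?q"
    using ij by (auto simp: C)
  have "(i, 0) \<otimes>\<^bsub>heis_M p n\<^esub> (0, j) = (i, j)"
    using ij' by (simp add: mult_heis_M)
  then have d: "r dvd z [(0, j)] - z [(i, j)] + z [(i, 0)]"
    using add[of "(i, 0)" "(0, j)"] ij' p0 by (simp add: C)
  have "r dvd z [(i, 0)] - z [(1, 0)] * i" "r dvd z [(0, j)] - z [(0, 1)] * j"
    using i[of "nat i"] j[of "nat j"] ij' by simp_all
  from dvd_diff[OF dvd_add[OF this] d] show ?thesis by (simp add: algebra_simps)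
qed

text \<open>
  Independence of the lift: two lifts of the same class differ by \<open>p z\<close>, and \<open>z\<close> is additive modulo
  \<open>p\<^sup>n\<^sup>-\<^sup>1\<close>, hence a linear form plus \<open>p\<^sup>n\<^sup>-\<^sup>1 t\<close>.  The linear form changes the Bockstein by a
  multiple of \<open>p\<close>, and \<open>t\<close> by the coboundary of \<open>t\<close>.
\<close>

lemma bockstein_heis_M:
  fixes x y :: "(int \<times> int) list \<Rightarrow> int"
  assumes p: "prime p" and char: "CHAR('k::field) = p" and n: "n \<ge> 1"
    and x: "x \<in> cochains (heis_M p n) 1" and y: "y \<in> cochains (heis_M p n) 2"
    and xy: "coboundary (heis_M p n) x = (\<lambda>ms. int (p ^ n) * y ms)"
  shows "bockstein (heis_M p n) p n 1 (coh_class (heis_M p n) 1 (\<lambda>ms. of_int (x ms) :: 'k))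
       = coh_class (heis_M p n) 2 (\<lambda>ms. of_int (y ms))"
  unfolding bockstein_def
proof (rule the_equality, goal_cases)
  case 1
  then show ?case
    using x y xy by auto
next
  case (2 v)
  let ?M = "heis_M p n"
  interpret M: monoid ?M by (rule monoid_heis_M)
  obtain x' y' where x': "x' \<in> cochains ?M 1" and y': "y' \<in> cochains ?M 2"
    and xy': "coboundary ?M x' = (\<lambda>gs. int (p ^ n) * y' gs)"
    and eq: "coh_class ?M 1 (\<lambda>ms. of_int (x ms) :: 'k) = coh_class ?M 1 (\<lambda>ms. of_int (x' ms))"
    and v: "v = coh_class ?M 2 (\<lambda>ms. of_int (y' ms))"
    using 2 by auto
  have p0: "p > 0" using p by (simp add: prime_gt_0_nat)
  define r where "r = int (p ^ (n - 1))"
  have r: "r > 0" "int (p ^ n) = int p * r"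
    using p0 n by (simp_all add: r_def flip: power_Suc)
  define z where "z ms = (x ms - x' ms) div int p" for ms
  \<comment> \<open>Classes of degree 1 are singletons, so equal classes have equal reductions and
    the lifts agree modulo \<open>p\<close> at every list.\<close>
  have "of_int (x ms - x' ms) = (0 :: 'k)" for ms
    using eq by (simp add: coh_class_1 fun_eq_iff)
  then have "int p dvd x ms - x' ms" for ms
    by (simp only: of_int_eq_0_iff_char_dvd char)
  then have pz: "x ms - x' ms = int p * z ms" for ms
    by (simp add: z_def)
  have "(\<lambda>ms. x ms - x' ms) \<in> cochains ?M 1"
    by (rule cochains_diff[OF x x'])
  then have z: "z \<in> cochains ?M 1"
    using p0 unfolding pz by (simp add: cochains_def)
  have "(\<lambda>ms. int p * coboundary ?M z ms) = (\<lambda>ms. int p * (r * (y ms - y' ms)))"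
    unfolding coboundary_mult[symmetric] pz[symmetric] coboundary_diff xy xy' r(2)
    by (simp add: algebra_simps)
  then have dz: "coboundary ?M z ms = r * (y ms - y' ms)" for ms
    using p0 by (simp add: fun_eq_iff)
  define \<chi> :: "int \<times> int \<Rightarrow> int" where "\<chi> = (\<lambda>(i, j). z [(1, 0)] * i + z [(0, 1)] * j)"
  have \<chi>: "\<exists>c d. \<chi> = (\<lambda>(i, j). c * i + d * j)" by (auto simp: \<chi>_def)
  let ?\<chi> = "cochain_of_hom ?M \<chi>"
  have "r dvd z ms - ?\<chi> ms" for ms
  proof (cases "length ms = 1 \<and> set ms \<subseteq> carrier ?M")
    case True
    then obtain i j where "ms = [(i, j)]" "(i, j) \<in> carrier ?M"
      using length_1_conv[of ms] by auto
    then show ?thesis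
      using additive_mod_linear[OF p n z, of r i j] dz by (simp add: cochain_of_hom_1 \<chi>_def)
  next
    case False
    then have "z ms = 0" "?\<chi> ms = 0"
      using z linear_cochains[OF p \<chi>, of n] by (auto intro!: cochainsD[of _ ?M 1])
    then show ?thesis by simp
  qed
  then obtain t where t: "\<And>ms. z ms - ?\<chi> ms = r * t ms"
    by (auto simp: dvd_def) metis
  have "(\<lambda>ms. z ms - ?\<chi> ms) \<in> cochains ?M 1"
    by (rule cochains_diff[OF z linear_cochains[OF p \<chi>]])
  then have t1: "t \<in> cochains ?M 1"
    using r(1) unfolding t by (simp add: cochains_def)
  have "(\<lambda>ms. r * coboundary ?M t ms) = (\<lambda>ms. r * (y ms - y' ms - int p * heis_beta p n \<chi> ms))"
    unfolding coboundary_mult[symmetric] t[symmetric] coboundary_diff dz coboundary_linear[OF p \<chi>] r(2)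
    by (simp add: algebra_simps)
  then have dt: "y ms - y' ms = coboundary ?M t ms + int p * heis_beta p n \<chi> ms" for ms
    using r(1) by (simp add: fun_eq_iff)
  have "of_int (y ms) - of_int (y' ms) = (of_int (coboundary ?M t ms) :: 'k)" for ms
    unfolding of_int_diff[symmetric] dt
    using of_int_power_CHAR[OF char, of 1 "heis_beta p n \<chi> ms"] by simp
  then have "(\<lambda>ms. of_int (y ms) - of_int (y' ms) :: 'k) = coboundary ?M (\<lambda>ms. of_int (t ms))"
    by (simp add: coboundary_of_int)
  then have "(\<lambda>ms. of_int (y ms) - of_int (y' ms) :: 'k) \<in> coboundaries ?M 2"
    using cochains_of_int[OF t1] unfolding coboundaries_def
    by (intro image_eqI[of _ _ "\<lambda>ms. of_int (t ms)"]) simp_all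
  then show ?case
    unfolding v by (intro coh_class_eqI[symmetric])
qed

lemma bockstein_linear:
  fixes \<chi> :: "int \<times> int \<Rightarrow> int"
  assumes p: "prime p" and \<chi>: "\<exists>c d. \<chi> = (\<lambda>(i, j). c * i + d * j)"
    and char: "CHAR('k::field) = p" and n: "n \<ge> 1"
  shows "bockstein (heis_M p n) p n 1
      (coh_class (heis_M p n) 1 (\<lambda>ms. of_int (cochain_of_hom (heis_M p n) \<chi> ms) :: 'k))
    = coh_class (heis_M p n) 2 (\<lambda>ms. of_int (heis_beta p n \<chi> ms))"
  using heis_beta_cocycles[OF p \<chi>, of n]
  by (intro bockstein_heis_M[OF p char n linear_cochains[OF p \<chi>] _ coboundary_linear[OF p \<chi>]])
     (simp add: cocycles_def)


section \<open>A cocycle of the Heisenberg group\<close>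

lemma heis_Q_carrier: "p > 0 \<Longrightarrow> carrier (heis_Q p n) = {0..<int (p ^ n)}"
  by (simp add: heis_Q_def carrier_integer_mod_group)

lemma carrier_heis:
  "p > 0 \<Longrightarrow> carrier (heis p n) = {0..<int (p ^ n)} \<times> {0..<int (p ^ n)} \<times> {0..<int (p ^ n)}"
  by (simp add: heis_def semidirect_def heis_Q_carrier carrier_heis_M)

lemma mult_heis:
  "(k, i, j) \<otimes>\<^bsub>heis p n\<^esub> (k', i', j') = ((k + k') mod int (p ^ n), (i + i') mod int (p ^ n),
     (j + k' * i + j') mod int (p ^ n))"
  by (simp add: heis_def semidirect_def heis_Q_def heis_M_def heis_act_def mod_simps)

lemma one_heis: "\<one>\<^bsub>heis p n\<^esub> = (0, 0, 0)"
  by (simp add: heis_def semidirect_def heis_Q_def one_heis_M)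

lemma monoid_heis:
  assumes "p > 0"
  shows "monoid (heis p n)"
proof (rule monoidI)
  fix a b c
  assume "a \<in> carrier (heis p n)" "b \<in> carrier (heis p n)" "c \<in> carrier (heis p n)"
  obtain k i j k' i' j' k'' i'' j'' where "a = (k, i, j)" "b = (k', i', j')" "c = (k'', i'', j'')"
    by (cases a, cases b, cases c)
  note abc = this
  define q where "q = int (p ^ n)"
  have "((j + k' * i + j') mod q + k'' * ((i + i') mod q) + j'') mod q
      = ((j + k' * i + j') + k'' * (i + i') + j'') mod q"
    by (intro mod_add_cong mod_mult_cong) simp_all
  also have "\<dots> = (j + (k' + k'') * i + (j' + k'' * i' + j'')) mod q"
    by (simp add: algebra_simps)
  also have "\<dots> = (j + ((k' + k'') mod q) * i + ((j' + k'' * i' + j'') mod q)) mod q"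
    by (intro mod_add_cong mod_mult_cong) simp_all
  finally show "a \<otimes>\<^bsub>heis p n\<^esub> b \<otimes>\<^bsub>heis p n\<^esub> c = a \<otimes>\<^bsub>heis p n\<^esub> (b \<otimes>\<^bsub>heis p n\<^esub> c)"
    unfolding abc mult_heis q_def[symmetric] by (simp add: mod_simps add.assoc)
qed (use assms in \<open>auto simp: carrier_heis mult_heis one_heis\<close>)

lemma heis_incl_hom:
  assumes "p > 0"
  shows "heis_incl \<in> hom (heis_M p n) (heis p n)"
  using assms by (auto simp: hom_def heis_incl_def carrier_heis carrier_heis_M mult_heis mult_heis_M)

lemma heis_act_hom:
  assumes "p > 0"
  shows "heis_act p n k \<in> hom (heis_M p n) (heis_M p n)"
proof -
  have "((j + j') mod q + k * ((i + i') mod q)) mod q = ((j + k * i) mod q + (j' + k * i') mod q) mod q"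
    for i j i' j' q :: int
  proof -
    have "((j + j') mod q + k * ((i + i') mod q)) mod q = ((j + j') + k * (i + i')) mod q"
      by (intro mod_add_cong mod_mult_cong) simp_all
    also have "\<dots> = ((j + k * i) + (j' + k * i')) mod q"
      by (simp add: algebra_simps)
    finally show ?thesis by (simp only: mod_add_eq)
  qed
  then show ?thesis
    using assms by (auto simp: hom_def heis_act_def carrier_heis_M mult_heis_M)
qed

text \<open>
  A cocycle modulo \<open>p\<^sup>n\<close>, since \<open>\<delta>j = - i \<union> k\<close> and \<open>\<delta> (i choose 2) = - i \<union> i\<close> modulo \<open>p\<^sup>n\<close>.  It
  represents a Massey product of the classes of \<open>i\<close>, \<open>i\<close> and \<open>k\<close>.
\<close>

definition heis_massey :: "nat \<Rightarrow> nat \<Rightarrow> (int \<times> int \<times> int) list \<Rightarrow> int" where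
  "heis_massey p n gs =
     (if length gs = 2 \<and> set gs \<subseteq> carrier (heis p n)
      then case (gs ! 0, gs ! 1) of ((k, i, j), (k', i', j')) \<Rightarrow> i * j' + i * (i - 1) div 2 * k'
      else 0)"

lemma heis_massey_cochains: "heis_massey p n \<in> cochains (heis p n) 2"
  by (rule cochains_2I) (auto simp: heis_massey_def one_heis)

text \<open>Modulo \<open>p^n\<close> the two summands have coboundaries
  \<open>i \<union> i \<union> k\<close> and \<open>- i \<union> i \<union> k\<close>. The halving
  in the binomial coefficient does not commute with reduction modulo \<open>p^n\<close>, so twice
  the coboundary is computed: it is polynomial in the reduced coordinates, and 2 is coprime to the
  odd number \<open>p^n\<close>.\<close>

lemma heis_massey_cocycle_mod:
  assumes p: "p > 0" "odd p"
  shows "int (p ^ n) dvd coboundary (heis p n) (heis_massey p n) gs"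
proof -
  interpret monoid "heis p n" by (rule monoid_heis[OF p(1)])
  show ?thesis
  proof (cases "length gs = 3 \<and> set gs \<subseteq> carrier (heis p n)")
    case True
    then obtain a b c where gs: "gs = [a, b, c]"
      and cl: "a \<in> carrier (heis p n)" "b \<in> carrier (heis p n)" "c \<in> carrier (heis p n)"
      by (auto simp: length_3_conv)
    obtain k1 i1 j1 k2 i2 j2 k3 i3 j3
      where abc: "a = (k1, i1, j1)" "b = (k2, i2, j2)" "c = (k3, i3, j3)"
      by (cases a, cases b, cases c)
    define q where "q = int (p ^ n)"
    define I K J where "I = (i1 + i2) mod q" and "K = (k2 + k3) mod q"
      and "J = (j2 + k3 * i2 + j3) mod q"
    have mu: "heis_massey p n [(k, i, j), (k', i', j')] = i * j' + i * (i - 1) div 2 * k'"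
      if "(k, i, j) \<in> carrier (heis p n)" "(k', i', j') \<in> carrier (heis p n)" for k i j k' i' j'
      using that by (simp add: heis_massey_def)
    define T :: "int \<Rightarrow> int" where "T i = i * (i - 1) div 2" for i
    have T: "2 * T i = i * (i - 1)" for i
      by (simp add: T_def)
    have eq: "coboundary (heis p n) (heis_massey p n) gs =
        (i2 * j3 + T i2 * k3) - (I * j3 + T I * k3) + (i1 * J + T i1 * K) - (i1 * j2 + T i1 * k2)"
      using cl m_closed[OF cl(1,2)] m_closed[OF cl(2,3)]
      unfolding gs abc by (simp add: coboundary_3 mult_heis mu I_def J_def K_def q_def T_def)
    have "2 * coboundary (heis p n) (heis_massey p n) gs =
        2 * i2 * j3 + i2 * (i2 - 1) * k3 - 2 * I * j3 - I * (I - 1) * k3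
        + 2 * i1 * J + i1 * (i1 - 1) * K - 2 * i1 * j2 - i1 * (i1 - 1) * k2"
      unfolding eq T[symmetric] by (simp add: algebra_simps)
    also have "\<dots> mod q = (2 * i2 * j3 + i2 * (i2 - 1) * k3 - 2 * (i1 + i2) * j3
        - (i1 + i2) * ((i1 + i2) - 1) * k3 + 2 * i1 * (j2 + k3 * i2 + j3)
        + i1 * (i1 - 1) * (k2 + k3) - 2 * i1 * j2 - i1 * (i1 - 1) * k2) mod q"
      unfolding I_def J_def K_def by (intro mod_add_cong mod_diff_cong mod_mult_cong) simp_all
    also have "\<dots> = 0"
      by (simp add: algebra_simps)
    finally have "q dvd 2 * coboundary (heis p n) (heis_massey p n) gs"
      by (simp only: dvd_eq_mod_eq_0)
    moreover have "coprime q 2"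
      using p(2) by (simp add: q_def)
    ultimately show ?thesis
      by (simp add: coprime_dvd_mult_right_iff q_def)
  next
    case False
    then show ?thesis
      using coboundary_outside[OF heis_massey_cochains, of gs p n] by auto
  qed
qed

text \<open>The division is exact; this is the negative of the Bockstein of the Massey product.\<close>

definition heis_nu :: "nat \<Rightarrow> nat \<Rightarrow> (int \<times> int \<times> int) list \<Rightarrow> int" where
  "heis_nu p n gs = - (coboundary (heis p n) (heis_massey p n) gs div int (p ^ n))"

context
  fixes p n :: nat
  assumes p: "p > 0" "odd p"
begin

lemma coboundary_heis_massey:
  "coboundary (heis p n) (heis_massey p n) = (\<lambda>gs. - int (p ^ n) * heis_nu p n gs)"
  using heis_massey_cocycle_mod[OF p] by (auto simp: heis_nu_def)

lemma heis_nu_cocycles: "heis_nu p n \<in> cocycles (heis p n) 3"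
proof -
  interpret monoid "heis p n" by (rule monoid_heis[OF p(1)])
  have "(\<lambda>gs. - int (p ^ n) * heis_nu p n gs) \<in> cochains (heis p n) 3"
    using coboundary_cochains_2[OF heis_massey_cochains] by (simp only: coboundary_heis_massey)
  then have "heis_nu p n \<in> cochains (heis p n) 3"
    using p(1) by (simp add: cochains_def)
  moreover have "(\<lambda>gs. - int (p ^ n) * coboundary (heis p n) (heis_nu p n) gs) = (\<lambda>_. 0)"
    using coboundary_coboundary_2[OF heis_massey_cochains]
    by (simp only: coboundary_heis_massey coboundary_mult)
  ultimately show ?thesis
    using p(1) by (auto simp: cocycles_def fun_eq_iff)
qed

end

text \<open>On \<open>M\<close> the coordinate \<open>k\<close> is zero, which kills the correction
  term and leaves \<open>x \<union> y\<close>. The Leibniz rule then expresses its coboundary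
  through the two Bockstein cocycles, and the common factor \<open>- p^n\<close> is cancelled over
  the integers.\<close>

lemma heis_nu_restrict:
  fixes p n :: nat
  assumes p: "prime p" "odd p"
  defines "x \<equiv> cochain_of_hom (heis_M p n) fst" and "y \<equiv> cochain_of_hom (heis_M p n) snd"
  shows "pullback (heis_M p n) heis_incl (heis_nu p n) =
    (\<lambda>ms. cup_cochain 1 x (heis_beta p n snd) ms - cup_cochain 2 (heis_beta p n fst) y ms)"
proof -
  let ?M = "heis_M p n"
  have p0: "p > 0" using p by (simp add: prime_gt_0_nat)
  interpret M: monoid ?M by (rule monoid_heis_M)
  have incl: "heis_incl \<in> hom ?M (heis p n)" "heis_incl \<one>\<^bsub>?M\<^esub> = \<one>\<^bsub>heis p n\<^esub>"
    using heis_incl_hom[OF p0] by (auto simp: one_heis one_heis_M heis_incl_def)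
  have xy: "x \<in> cochains ?M 1" "y \<in> cochains ?M 1"
    using linear_cochains[OF p(1)] linear_fst linear_snd by (auto simp: x_def y_def)
  have "pullback ?M heis_incl (heis_massey p n) = cup_cochain 1 x y"
  proof (rule cochains_eqI)
    show "pullback ?M heis_incl (heis_massey p n) \<in> cochains ?M 2"
      by (rule pullback_cochains[OF incl heis_massey_cochains])
    show "cup_cochain 1 x y \<in> cochains ?M 2"
      using cup_cochain_cochains[OF xy] by simp
    fix ms assume "int (length ms) = 2" "set ms \<subseteq> carrier ?M"
    then obtain a b where ms: "ms = [a, b]" and ab: "a \<in> carrier ?M" "b \<in> carrier ?M"
      using length_2_conv[of ms] by auto
    have "heis_incl a \<in> carrier (heis p n)" "heis_incl b \<in> carrier (heis p n)"
      using incl ab by (auto simp: hom_def)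
    then show "pullback ?M heis_incl (heis_massey p n) ms = cup_cochain 1 x y ms"
      using ab by (simp add: ms pullback_def heis_massey_def cup_cochain_1 x_def y_def cochain_of_hom_1)
        (simp add: heis_incl_def split: prod.split)
  qed
  then have "pullback ?M heis_incl (coboundary (heis p n) (heis_massey p n)) =
      coboundary ?M (cup_cochain 1 x y)"
    using coboundary_pullback[OF monoid_heis_M incl(1), of "heis_massey p n"] by simp
  also have "\<dots> = (\<lambda>ms. cup_cochain 2 (coboundary ?M x) y ms - cup_cochain 1 x (coboundary ?M y) ms)"
    by (rule M.coboundary_cup_1_1[OF xy])
  also have "\<dots> = (\<lambda>ms. - int (p ^ n) *
      (cup_cochain 1 x (heis_beta p n snd) ms - cup_cochain 2 (heis_beta p n fst) y ms))"
    unfolding x_def y_def coboundary_linear[OF p(1) linear_fst] coboundary_linear[OF p(1) linear_snd]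
    by (rule ext) (simp add: cup_cochain_def algebra_simps)
  finally have "- int (p ^ n) * pullback ?M heis_incl (heis_nu p n) ms = - int (p ^ n) *
      (cup_cochain 1 x (heis_beta p n snd) ms - cup_cochain 2 (heis_beta p n fst) y ms)" for ms
    unfolding coboundary_heis_massey[OF p0 p(2)] pullback_def
    by (auto dest!: fun_cong[of _ _ ms] split: if_splits)
  then show ?thesis
    using p0 by (auto simp: fun_eq_iff)
qed

theorem proposition5p4:
  fixes p n :: nat
    and x1 y1 x2 y2 \<nu>3 :: "((int \<times> int) list \<Rightarrow> 'k::field) set"
  assumes "prime p" and "odd p" and "n \<ge> 2" and "CHAR('k) = p"
    and "x1 = heis_a_dual p n" and "y1 = heis_b_dual p n"
    and "x2 = bockstein (heis_M p n) p n 1 x1" and "y2 = bockstein (heis_M p n) p n 1 y1"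
    and "\<nu>3 = cup (heis_M p n) 1 2 x1 y2
                \<otimes>\<^bsub>cohomology (heis_M p n) 3\<^esub>
              inv\<^bsub>cohomology (heis_M p n) 3\<^esub> (cup (heis_M p n) 1 2 y1 x2)"
  shows "\<nu>3 \<in> heis_invariants p n 3 \<and>
         (\<exists>!\<xi>. \<xi> \<in> carrier (heis_E p n 2 0 3) \<and> heis_edge p n 3 \<xi> = \<nu>3) \<and>
         (\<forall>\<xi> \<in> carrier (heis_E p n 2 0 3). heis_edge p n 3 \<xi> = \<nu>3 \<longrightarrow>
            heis_d p n 2 0 3 \<xi> = \<one>\<^bsub>heis_E p n 2 2 2\<^esub>)"
proof -
  let ?M = "heis_M p n" and ?G = "heis p n"
  let ?cx = "cochain_of_hom ?M fst" and ?cy = "cochain_of_hom ?M snd"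
  let ?x = "\<lambda>ms. of_int (?cx ms) :: 'k" and ?y = "\<lambda>ms. of_int (?cy ms) :: 'k"
  let ?X = "\<lambda>ms. of_int (heis_beta p n fst ms) :: 'k" and ?Y = "\<lambda>ms. of_int (heis_beta p n snd ms) :: 'k"
  let ?w = "\<lambda>gs. of_int (heis_nu p n gs) :: 'k"
  have p: "prime p" "odd p" and n: "n \<ge> 1" and char: "CHAR('k) = p"
    using assms(1-4) by auto
  have p0: "p > 0" using p by (simp add: prime_gt_0_nat)
  interpret M: monoid ?M by (rule monoid_heis_M)
  note lin = linear_fst linear_snd
  have x: "?x \<in> cocycles ?M 1" and y: "?y \<in> cocycles ?M 1"
    using lin by (auto intro!: linear_cocycles[OF p(1) _ char n])
  have X: "?X \<in> cocycles ?M 2" and Y: "?Y \<in> cocycles ?M 2"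
    using lin by (auto intro!: cocycles_of_int heis_beta_cocycles[OF p(1)])
  \<comment> \<open>The dual classes are given by homomorphisms into \<open>K\<close>; rewriting
    them as reductions of integral cochains exhibits the lifts from which the Bockstein is
    computed.\<close>
  have x1: "x1 = coh_class ?M 1 ?x" and y1: "y1 = coh_class ?M 1 ?y"
    unfolding assms(5,6) heis_a_dual_def heis_b_dual_def
    by (rule arg_cong[of _ _ "coh_class ?M 1"]; auto simp: cochain_of_hom_def fun_eq_iff split: prod.split)+
  have x2: "x2 = coh_class ?M 2 ?X" and y2: "y2 = coh_class ?M 2 ?Y"
    unfolding assms(7,8) x1 y1 by (intro bockstein_linear[OF p(1) _ char n] lin)+
  have w: "?w \<in> cocycles ?G 3"
    by (intro cocycles_of_int heis_nu_cocycles p0 p)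
  have incl: "heis_incl \<in> hom ?M ?G" "heis_incl \<one>\<^bsub>?M\<^esub> = \<one>\<^bsub>?G\<^esub>" "inj_on heis_incl (carrier ?M)"
    using heis_incl_hom[OF p0] by (auto simp: one_heis one_heis_M heis_incl_def inj_on_def)
  let ?res = "pullback ?M heis_incl ?w"
  have "?res ms = of_int (pullback ?M heis_incl (heis_nu p n) ms)" for ms
    by (simp add: pullback_def)
  then have res: "?res = (\<lambda>ms. cup_cochain 1 ?x ?Y ms - cup_cochain 2 ?X ?y ms)"
    by (intro ext) (simp add: heis_nu_restrict[OF p] cup_cochain_def)
  have "\<nu>3 = coh_class ?M 3 (\<lambda>ms. cup_cochain 1 ?x ?Y ms - cup_cochain 1 ?y ?X ms)"
    unfolding assms(9) x1 y1 x2 y2 M.cup_coh_class_1_2[OF x] M.cup_coh_class_1_2[OF y]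
    by (intro M.coh_class_diff_3 M.cup_cocycles_1_2 x y X Y)
  also have "\<dots> = coh_class ?M 3 ?res"
    \<comment> \<open>The restriction contains \<open>X \<union> y\<close> where
      \<open>\<nu>3\<close> has \<open>y \<union> X\<close>. Degrees 2 and 1 commute with sign +1,
      so the two cochains differ by a coboundary.\<close>
    using M.cup_commute_1_2[OF y X] by (intro coh_class_eqI) (simp add: res algebra_simps)
  finally have \<nu>: "\<nu>3 = coh_class ?M 3 ?res" .
  have "?res \<in> cocycles ?M 3"
    using w pullback_cochains[OF incl(1,2), of ?w 3] unfolding cocycles_def
    by (simp add: coboundary_pullback[OF monoid_heis_M incl(1)] pullback_zero)
  then have "\<nu>3 \<in> carrier (cohomology ?M 3)"
    unfolding \<nu> by (rule coh_class_in_cohomology)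
  moreover have "pullback_class ?M (heis_act p n k) 3 \<nu>3 = \<nu>3" if k: "k \<in> carrier (heis_Q p n)" for k
  proof -
    have act: "heis_act p n k \<in> hom ?M ?M" "heis_act p n k \<one>\<^bsub>?M\<^esub> = \<one>\<^bsub>?M\<^esub>"
      using heis_act_hom[OF p0] by (auto simp: one_heis_M heis_act_def)
    have "pullback_class ?M (heis_act p n k) 3 \<nu>3 = coh_class ?M 3 (pullback ?M (heis_act p n k) ?res)"
      unfolding \<nu> by (rule pullback_class_coh_class[OF monoid_heis_M act])
    also have "\<dots> = \<nu>3"
      unfolding \<nu>
    \<comment> \<open>\<open>heis_act p n k\<close> is conjugation by \<open>(k, 0, 0)\<close>
      inside \<open>G\<close>, and the class is restricted from \<open>G\<close>; invariance
      therefore needs no computation with the action on \<open>x1\<close> and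
      \<open>y1\<close>.\<close>
    proof (intro coh_class_eqI pullback_conjugate[OF monoid_heis[OF p0] monoid_heis_M incl(1,2) act _ _ w])
      show "(k, 0, 0) \<in> carrier ?G"
        using k p0 by (simp add: heis_Q_carrier carrier_heis)
      show "heis_incl m \<otimes>\<^bsub>?G\<^esub> (k, 0, 0) = (k, 0, 0) \<otimes>\<^bsub>?G\<^esub> heis_incl (heis_act p n k m)"
        if "m \<in> carrier ?M" for m
        by (cases m) (simp add: heis_incl_def heis_act_def mult_heis)
    qed
    finally show ?thesis .
  qed
  ultimately have "\<nu>3 \<in> heis_invariants p n 3"
    by (simp add: heis_invariants_def)
  then show ?thesis
    using lhs_edge_cocycle[OF monoid_heis[OF p0] monoid_heis_M incl w]
    unfolding heis_E_def heis_d_def heis_edge_def heis_N_def \<nu> by blast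
qed

end
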